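(* There are constants $\Sigma_q$ ($q>2$), depending only on $q$, with $\Sigma_q=O(q^{1/2+1/q})$ as $q\to\infty$, such that the following holds. Let $\Omega\subset\mathbb{R}^2$ be an arbitrary domain with $\partial\Omega\neq\emptyset$. Then, if $u\in H^1_0(\Omega)$ and $q>2$, \[ \left(\int_\Omega\frac{|u|^q}{\delta^2}\right)^{1/q}\leq \Sigma_q\left(\int_\Omega |\nabla u|^2+\frac{u^2}{\delta^2}\right)^{1/2}. \]
   Context: A domain is a connected open set. $\delta(x)$ denotes the distance from $x\in\Omega$ to $\partial\Omega$. Functions are real-valued and integrals are with respect to Lebesgue measure. The right-hand side is allowed to be $+\infty$, in which case the inequality is trivially true. *)

theory Defs
  imports "HOL-Analysis.Analysis" "HOL-Library.Landau_Symbols"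
begin

(* C^k on the whole space, by iterated partial derivatives. *)
primrec Ck :: "nat \<Rightarrow> ('a::euclidean_space \<Rightarrow> real) \<Rightarrow> bool" where
  "Ck 0 f \<longleftrightarrow> continuous_on UNIV f"
| "Ck (Suc k) f \<longleftrightarrow> (\<forall>x. f differentiable (at x)) \<and>
     (\<forall>b\<in>Basis. Ck k (\<lambda>x. frechet_derivative f (at x) b))"

definition gradient :: "('a::euclidean_space \<Rightarrow> real) \<Rightarrow> 'a \<Rightarrow> 'a" where
  "gradient f x = (\<Sum>b\<in>Basis. frechet_derivative f (at x) b *\<^sub>R b)"

(* The space of smooth functions with compact support in \<Omega>, each function being
   extended by zero to the whole space. *)
definition test_functions :: "'a::euclidean_space set \<Rightarrow> ('a \<Rightarrow> real) set" where
  "test_functions \<Omega> =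
     {\<phi>. (\<forall>k. Ck k \<phi>) \<and> compact (closure {x. \<phi> x \<noteq> 0}) \<and> closure {x. \<phi> x \<noteq> 0} \<subseteq> \<Omega>}"

definition locally_integrable ::
  "'a::euclidean_space set \<Rightarrow> ('a \<Rightarrow> 'b::euclidean_space) \<Rightarrow> bool" where
  "locally_integrable \<Omega> f \<longleftrightarrow> (\<forall>K. compact K \<and> K \<subseteq> \<Omega> \<longrightarrow> set_integrable lebesgue K f)"

definition L2_on :: "'a::euclidean_space set \<Rightarrow> ('a \<Rightarrow> 'b::euclidean_space) \<Rightarrow> bool" where
  "L2_on \<Omega> f \<longleftrightarrow> set_borel_measurable lebesgue \<Omega> f \<and>
     set_integrable lebesgue \<Omega> (\<lambda>x. (norm (f x))\<^sup>2)"

definition is_weak_gradient ::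
  "'a::euclidean_space set \<Rightarrow> ('a \<Rightarrow> real) \<Rightarrow> ('a \<Rightarrow> 'a) \<Rightarrow> bool" where
  "is_weak_gradient \<Omega> u g \<longleftrightarrow> locally_integrable \<Omega> u \<and> locally_integrable \<Omega> g \<and>
     (\<forall>\<phi>\<in>test_functions \<Omega>.
        (LINT x:\<Omega>|lebesgue. u x *\<^sub>R gradient \<phi> x) = - (LINT x:\<Omega>|lebesgue. \<phi> x *\<^sub>R g x))"

(* Weak gradients on an open set are unique up to null sets, so the choice of a
   representative is immaterial under integrals over \<Omega>. *)
definition weak_gradient :: "'a::euclidean_space set \<Rightarrow> ('a \<Rightarrow> real) \<Rightarrow> 'a \<Rightarrow> 'a" where
  "weak_gradient \<Omega> u = (SOME g. is_weak_gradient \<Omega> u g)"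

(* Sobolev functions are represented by pointwise functions; their values
   outside \<Omega> play no role. *)
definition H1 :: "'a::euclidean_space set \<Rightarrow> ('a \<Rightarrow> real) set" where
  "H1 \<Omega> = {u. L2_on \<Omega> u \<and> (\<exists>g. is_weak_gradient \<Omega> u g \<and> L2_on \<Omega> g)}"

(* The closure of the test functions in the norm of H1. The extended nonnegative
   integral is the square of the H1-distance between u and \<phi>, since the weak
   gradient of a test function is its classical gradient. *)
definition H1_0 :: "'a::euclidean_space set \<Rightarrow> ('a \<Rightarrow> real) set" where
  "H1_0 \<Omega> = {u \<in> H1 \<Omega>. \<forall>\<epsilon>>0. \<exists>\<phi>\<in>test_functions \<Omega>.
     (\<integral>\<^sup>+ x\<in>\<Omega>. ennreal ((norm (weak_gradient \<Omega> u x - gradient \<phi> x))\<^sup>2 + (u x - \<phi> x)\<^sup>2)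
        \<partial>lebesgue) < ennreal (\<epsilon>\<^sup>2)}"

definition bdist :: "'a::euclidean_space set \<Rightarrow> 'a \<Rightarrow> real" where
  "bdist \<Omega> x = infdist x (frontier \<Omega>)"

(* Real powers of extended nonnegative numbers, for positive exponents p. *)
definition ennpowr :: "ennreal \<Rightarrow> real \<Rightarrow> ennreal" where
  "ennpowr a p = (if a = \<infinity> then \<infinity> else ennreal (enn2real a powr p))"

end

theory Submission
  imports Defs
begin

text \<open>
  The inequality is a local one, summed up over \<open>\<Omega>\<close> by integration. Write \<open>\<delta>\<close> for the distance
  to the frontier and \<open>B\<^sub>x\<close> for the ball around \<open>x\<close> of radius \<open>\<delta>(x)/2\<close>. For a smooth function \<open>\<phi>\<close>,
  integrating its derivative along all segments from \<open>x\<close> into \<open>B\<^sub>x\<close> gives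
  \<open>|\<phi>(x)| \<le> \<integral>\<^bsub>B\<^sub>x\<^esub> h(z) / |z - x| dz\<close> with \<open>h = |\<nabla>\<phi>| + |\<phi>| / \<delta>\<close>
  (\<open>abs_le_Riesz_potential\<close>).

  Hoelder's inequality with weights \<open>1/q\<close>, \<open>1/2 - 1/q\<close>, \<open>1/2\<close> then bounds \<open>|\<phi>(x)|\<^sup>q\<close> by
  \<open>(\<pi> q)\<^bsup>q/2\<^esup> \<delta>(x) (\<integral> h\<^sup>2)\<^bsup>q/2-1\<^esup> \<integral>\<^bsub>B\<^sub>x\<^esub> h(z)\<^sup>2 / |z - x| dz\<close>
  (\<open>Riesz_potential_powr_bound\<close>); the factor \<open>q\<^bsup>q/2\<^esup>\<close> comes from the integral of
  \<open>|z - x|\<^bsup>-(2 - 2/q)\<^esup>\<close>, which blows up linearly in \<open>q\<close>, and is responsible for the growth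
  \<open>q\<^bsup>1/2\<^esup>\<close> of the constant. Dividing by \<open>\<delta>\<^sup>2\<close>, integrating in \<open>x\<close> and exchanging the integrals
  leaves \<open>(\<pi> q)\<^bsup>q/2\<^esup> (\<integral> h\<^sup>2)\<^bsup>q/2\<^esup>\<close> times an absolute constant,
  because \<open>\<delta>\<close> is comparable to \<open>\<delta>(x)\<close> on \<open>B\<^sub>x\<close> (\<open>weighted_Lq_estimate\<close>). No covering of \<open>\<Omega>\<close> is chosen.

  For \<open>u\<close> in the closure of the test functions, the weighted energy of the approximations need not
  converge, as the norm of \<open>H\<^sup>1\<close> does not see the weight. But \<open>B\<^sub>x\<close> stays in \<open>{\<delta> \<ge> \<epsilon>/2}\<close>
  when \<open>\<delta>(x) \<ge> \<epsilon>\<close>, so the estimate can be truncated to sets where the weight is bounded. There one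
  passes to the limit (\<open>nn_integral_truncated_le_of_H1_0\<close>), and afterwards lets \<open>\<epsilon>\<close> tend to 0.
\<close>

section \<open>The kernel and its integral over a ball\<close>

text \<open>The right-hand side is visibly measurable jointly in centre, radius and point, which is what
  each exchange of integrals below requires.\<close>

lemma indicator_ball_eq: "indicator (ball x r) z = (if dist x z < r then 1 else 0)"
  by (simp add: indicator_def)

lemma nn_integral_powr_atMost:
  fixes c e :: real
  assumes "0 < c" "- 1 < e"
  shows "(\<integral>\<^sup>+t\<in>{0..c}. ennreal (t powr e) \<partial>lborel) = ennreal (c powr (e + 1) / (e + 1))"
  using nn_integral_has_integral_lebesgue'[OF _ has_integral_powr_from_0[of e c]] assms by simp

lemma nn_integral_powr_atLeast:
  fixes c e :: real
  assumes "0 < c" "e < - 1"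
  shows "(\<integral>\<^sup>+t\<in>{c..}. ennreal (t powr e) \<partial>lborel) = ennreal (- (c powr (e + 1)) / (e + 1))"
  using nn_integral_has_integral_lebesgue'[OF _ has_integral_powr_to_inf[of e c]] assms by simp

text \<open>Layer cake: \<open>|w| powr - a\<close> is the integral of \<open>a * t powr (- a - 1)\<close> over \<open>t \<ge> |w|\<close>. After
  exchanging the integrals, the level \<open>t\<close> contributes the volume of a ball of radius \<open>min t \<rho>\<close>,
  and two integrals of powers remain. What matters is that the constant grows only like
  \<open>1 / (DIM('a) - a)\<close> as the singularity becomes critical: its square root is the growth in \<open>q\<close>
  of the final estimate.\<close>

lemma nn_integral_ball_norm_powr:
  fixes x :: "'a::euclidean_space" and a :: real
  assumes "0 < a" "a < DIM('a)" "0 < \<rho>"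
  shows "(\<integral>\<^sup>+z\<in>ball x \<rho>. ennreal (norm (z - x) powr - a) \<partial>lborel)
    \<le> ennreal (DIM('a) * unit_ball_vol DIM('a) * \<rho> powr (DIM('a) - a) / (DIM('a) - a))"
proof -
  define n where "n = real DIM('a)"
  define \<omega> where "\<omega> = unit_ball_vol n"
  have \<omega>: "0 \<le> \<omega>" by (simp add: \<omega>_def n_def)
  let ?f = "\<lambda>z t. ennreal (a * t powr (- a - 1)) * indicator {norm (z - x)..} t * indicator (ball x \<rho>) z"
  have "(\<integral>\<^sup>+z\<in>ball x \<rho>. ennreal (norm (z - x) powr - a) \<partial>lborel)
      \<le> (\<integral>\<^sup>+z. (\<integral>\<^sup>+t. ?f z t \<partial>lborel) \<partial>lborel)"
  proof (rule nn_integral_mono)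
    fix z
    \<comment> \<open>At \<open>z = x\<close> the representation fails, but there the left-hand side is \<open>0 powr - a = 0\<close>.\<close>
    show "ennreal (norm (z - x) powr - a) * indicator (ball x \<rho>) z \<le> (\<integral>\<^sup>+t. ?f z t \<partial>lborel)"
    proof (cases "norm (z - x) = 0")
      case False
      then have "(\<integral>\<^sup>+t\<in>{norm (z - x)..}. ennreal (t powr (- a - 1)) \<partial>lborel)
          = ennreal (norm (z - x) powr - a / a)"
        using nn_integral_powr_atLeast[of "norm (z - x)" "- a - 1"] assms by simp
      then have "ennreal (norm (z - x) powr - a)
          = ennreal a * (\<integral>\<^sup>+t\<in>{norm (z - x)..}. ennreal (t powr (- a - 1)) \<partial>lborel)"
        using assms by (simp add: ennreal_mult'[symmetric])
      also have "\<dots> = (\<integral>\<^sup>+t\<in>{norm (z - x)..}. ennreal (a * t powr (- a - 1)) \<partial>lborel)"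
        using assms by (simp add: nn_integral_cmult[symmetric] ennreal_mult mult.assoc)
      finally show ?thesis
        by (simp add: nn_integral_multc)
    qed simp
  qed
  also have "\<dots> = (\<integral>\<^sup>+t. (\<integral>\<^sup>+z. ?f z t \<partial>lborel) \<partial>lborel)"
    by (rule lborel_pair.Fubini') (simp add: indicator_ball_eq, simp add: indicator_def)
  also have "\<dots> \<le> (\<integral>\<^sup>+t. ennreal (\<omega> * a) * (ennreal (t powr (n - a - 1)) * indicator {0..\<rho>} t) +
      ennreal (\<omega> * \<rho> powr n * a) * (ennreal (t powr (- a - 1)) * indicator {\<rho>..} t) \<partial>lborel)"
  proof (rule nn_integral_mono)
    fix t :: real
    show "(\<integral>\<^sup>+z. ?f z t \<partial>lborel) \<le>
      ennreal (\<omega> * a) * (ennreal (t powr (n - a - 1)) * indicator {0..\<rho>} t) +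
      ennreal (\<omega> * \<rho> powr n * a) * (ennreal (t powr (- a - 1)) * indicator {\<rho>..} t)" (is "?l \<le> ?r")
    proof (cases "0 < t")
      case False
      have "?f z t = 0" for z
      proof (cases "t = 0")
        case False
        then have "t < norm (z - x)" using \<open>\<not> 0 < t\<close> norm_ge_zero[of "z - x"] by linarith
        then show ?thesis by simp
      qed simp
      then have "?l = (\<integral>\<^sup>+(z::'a). 0 \<partial>lborel)" by (simp only:)
      then show ?thesis by simp
    next
      case True
      have e: "emeasure lborel (cball x r) = ennreal (\<omega> * r powr n)" if "0 < r" for r
        using that by (simp add: emeasure_cball \<omega>_def n_def powr_realpow)
      have "?l \<le> (\<integral>\<^sup>+z. ennreal (a * t powr (- a - 1)) * indicator (cball x (min t \<rho>)) z \<partial>lborel)"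
        by (rule nn_integral_mono) (auto simp: indicator_def dist_norm norm_minus_commute)
      also have "\<dots> = ennreal (a * t powr (- a - 1)) * ennreal (\<omega> * min t \<rho> powr n)"
        using True assms by (simp add: nn_integral_cmult_indicator e)
      also have "\<dots> \<le> ?r"
      proof (cases "t \<le> \<rho>")
        case le: True
        have "ennreal (a * t powr (- a - 1)) * ennreal (\<omega> * min t \<rho> powr n)
            = ennreal (\<omega> * a) * ennreal (t powr (n - a - 1))"
          using le assms True \<omega>
          by (simp add: ennreal_mult[symmetric] powr_add[symmetric] algebra_simps)
        then show ?thesis using le True by simp
      next
        case False
        then show ?thesis using assms True \<omega>
          by (simp add: ennreal_mult[symmetric])
      qed
      finally show ?thesis .
    qed
  qed
  also have "\<dots> = ennreal (\<omega> * a * (\<rho> powr (n - a) / (n - a)))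
      + ennreal (\<omega> * \<rho> powr n * a * (\<rho> powr - a / a))"
    using assms \<omega> nn_integral_powr_atMost[of \<rho> "n - a - 1"] nn_integral_powr_atLeast[of \<rho> "- a - 1"]
    by (subst nn_integral_add)
       (simp_all add: nn_integral_cmult n_def ennreal_mult[symmetric])
  also have "\<dots> = ennreal (\<omega> * a * (\<rho> powr (n - a) / (n - a)) + \<omega> * \<rho> powr (n - a))"
    using assms \<omega> by (simp add: ennreal_plus[symmetric] n_def powr_add[symmetric] powr_diff powr_minus divide_inverse del: ennreal_plus)
  also have "\<omega> * a * (\<rho> powr (n - a) / (n - a)) + \<omega> * \<rho> powr (n - a) = n * \<omega> * \<rho> powr (n - a) / (n - a)"
    using assms by (simp add: n_def field_simps)
  finally show ?thesis by (simp add: n_def \<omega>_def)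
qed

lemma nn_integral_affine:
  fixes x :: "'a::euclidean_space"
  assumes [measurable]: "f \<in> borel_measurable borel" and "c \<noteq> 0"
  shows "(\<integral>\<^sup>+y. f (x + c *\<^sub>R y) \<partial>lborel) = ennreal (1 / \<bar>c\<bar> ^ DIM('a)) * (\<integral>\<^sup>+z. f z \<partial>lborel)"
proof -
  have "(\<integral>\<^sup>+z. f z \<partial>lborel) = ennreal (\<bar>c\<bar> ^ DIM('a)) * (\<integral>\<^sup>+y. f (x + c *\<^sub>R y) \<partial>lborel)"
    by (subst lborel_affine[OF \<open>c \<noteq> 0\<close>, of x])
       (simp add: nn_integral_density nn_integral_distr nn_integral_cmult ennreal_power)
  then show ?thesis using \<open>c \<noteq> 0\<close>
    by (simp add: mult.assoc[symmetric] ennreal_mult[symmetric])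
qed

section \<open>Pointwise control by a Riesz potential\<close>

text \<open>The segment is left open at \<open>t = 0\<close> because the homothety that replaces \<open>y\<close> by the point on
  the segment, used next, degenerates there.\<close>

lemma increment_le_nn_integral_segment:
  fixes \<phi> :: "'a::euclidean_space \<Rightarrow> real"
  assumes der: "\<And>z. (\<phi> has_derivative (\<lambda>v. G z \<bullet> v)) (at z)" and cont: "continuous_on UNIV G"
  shows "ennreal \<bar>\<phi> y - \<phi> x\<bar>
    \<le> (\<integral>\<^sup>+t\<in>{0<..1}. ennreal (norm (G (x + t *\<^sub>R (y - x))) * norm (y - x)) \<partial>lborel)"
proof -
  let ?p = "\<lambda>t. x + t *\<^sub>R (y - x)"
  let ?g = "\<lambda>t. norm (G (?p t)) * norm (y - x)"
  have contG: "continuous_on A (\<lambda>t. G (?p t))" for A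
    by (rule continuous_on_compose2[OF cont]) (auto intro!: continuous_intros)
  have "((\<lambda>t. \<phi> (?p t)) has_vector_derivative G (?p t) \<bullet> (y - x)) (at t within {0..1})" for t
    unfolding has_vector_derivative_def
    by (rule has_derivative_eq_rhs, rule has_derivative_compose[OF _ der])
      (auto intro!: derivative_eq_intros)
  then have "((\<lambda>t. G (?p t) \<bullet> (y - x)) has_integral \<phi> (?p 1) - \<phi> (?p 0)) {0..1}"
    by (intro fundamental_theorem_of_calculus) auto
  then have I: "(\<lambda>t. G (?p t) \<bullet> (y - x)) integrable_on {0..1}"
    "integral {0..1} (\<lambda>t. G (?p t) \<bullet> (y - x)) = \<phi> y - \<phi> x"
    by (auto simp: has_integral_iff)
  have g: "?g integrable_on {0..1}"
    by (intro integrable_continuous_interval continuous_intros contG)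
  have "norm (integral {0..1} (\<lambda>t. G (?p t) \<bullet> (y - x))) \<le> integral {0..1} ?g"
    by (rule integral_norm_bound_integral[OF I(1) g]) (simp add: Cauchy_Schwarz_ineq2)
  then have "\<bar>\<phi> y - \<phi> x\<bar> \<le> integral {0..1} ?g"
    by (simp only: I(2) real_norm_def)
  then have "ennreal \<bar>\<phi> y - \<phi> x\<bar> \<le> ennreal (integral {0..1} ?g)"
    by (rule ennreal_leI)
  also have "\<dots> = (\<integral>\<^sup>+t\<in>{0..1}. ennreal (?g t) \<partial>lborel)"
    using nn_integral_has_integral_lebesgue'[OF _ integrable_integral[OF g]] by simp
  also have "\<dots> = (\<integral>\<^sup>+t\<in>{0<..1}. ennreal (?g t) \<partial>lborel)"
    by (rule nn_integral_cong_AE, use AE_lborel_singleton[of "0::real"] in eventually_elim)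
       (auto simp: indicator_def)
  finally show ?thesis .
qed

text \<open>Integrate the increments along all segments from \<open>x\<close>. For fixed \<open>t\<close> the homothety
  \<open>y \<mapsto> x + t (y - x)\<close> turns the integral over \<open>ball x \<rho>\<close> into one over \<open>ball x (t \<rho>)\<close>, with
  Jacobian \<open>t powr - n\<close> where \<open>n\<close> is the dimension, and \<open>|y - x|\<close> becomes \<open>|z - x| / t\<close>. A point
  \<open>z\<close> is then met only for \<open>t > |z - x| / \<rho>\<close>, and integrating \<open>t powr (- n - 1)\<close> over these \<open>t\<close>
  leaves the Riesz kernel. This avoids polar coordinates.\<close>

lemma nn_integral_increment_le_Riesz_potential:
  fixes \<phi> :: "'a::euclidean_space \<Rightarrow> real"
  assumes der: "\<And>z. (\<phi> has_derivative (\<lambda>v. G z \<bullet> v)) (at z)" and cont: "continuous_on UNIV G"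
    and "0 < \<rho>"
  shows "(\<integral>\<^sup>+y\<in>ball x \<rho>. ennreal \<bar>\<phi> y - \<phi> x\<bar> \<partial>lborel)
    \<le> ennreal (\<rho> ^ DIM('a) / DIM('a)) *
       (\<integral>\<^sup>+z\<in>ball x \<rho>. ennreal (norm (G z) * norm (z - x) powr (1 - real DIM('a))) \<partial>lborel)"
proof -
  define n where "n = real DIM('a)"
  have [measurable]: "G \<in> borel_measurable borel"
    using cont by (rule borel_measurable_continuous_onI)
  have n: "0 < n" by (simp add: n_def)
  let ?f = "\<lambda>t z. ennreal (norm (G z) * norm (z - x) * t powr (- n - 1)) * indicator (ball x (t * \<rho>)) z"
  let ?p = "\<lambda>t y. x + t *\<^sub>R (y - x)"
  have "(\<integral>\<^sup>+y\<in>ball x \<rho>. ennreal \<bar>\<phi> y - \<phi> x\<bar> \<partial>lborel)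
     \<le> (\<integral>\<^sup>+y\<in>ball x \<rho>. (\<integral>\<^sup>+t\<in>{0<..1}. ennreal (norm (G (?p t y)) * norm (y - x)) \<partial>lborel) \<partial>lborel)"
    by (intro nn_integral_mono mult_right_mono increment_le_nn_integral_segment[OF der cont]) simp
  also have "\<dots> = (\<integral>\<^sup>+y. \<integral>\<^sup>+t. ennreal (norm (G (?p t y)) * norm (y - x)) * indicator {0<..1} t
      * indicator (ball x \<rho>) y \<partial>lborel \<partial>lborel)"
    by (simp add: nn_integral_multc)
  also have "\<dots> = (\<integral>\<^sup>+t. \<integral>\<^sup>+y. ennreal (norm (G (?p t y)) * norm (y - x)) * indicator {0<..1} t
      * indicator (ball x \<rho>) y \<partial>lborel \<partial>lborel)"
    by (rule lborel_pair.Fubini') (simp add: indicator_ball_eq)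
  also have "\<dots> = (\<integral>\<^sup>+t. \<integral>\<^sup>+z. ?f t z * indicator {0<..1} t \<partial>lborel \<partial>lborel)"
  proof (rule nn_integral_cong)
    fix t :: real
    show "(\<integral>\<^sup>+y. ennreal (norm (G (?p t y)) * norm (y - x)) * indicator {0<..1} t
      * indicator (ball x \<rho>) y \<partial>lborel) = (\<integral>\<^sup>+z. ?f t z * indicator {0<..1} t \<partial>lborel)"
    proof (cases "t \<in> {0<..1}")
      case True
      then have t: "0 < t" "t \<le> 1" by auto
      have "ennreal (norm (G (?p t y)) * norm (y - x)) * indicator {0<..1} t * indicator (ball x \<rho>) y
          = ennreal (t ^ DIM('a)) * ?f t ((x - t *\<^sub>R x) + t *\<^sub>R y)" for y
      proof -
        have e: "(x - t *\<^sub>R x) + t *\<^sub>R y = ?p t y" by (simp add: algebra_simps)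
        have ind: "indicator (ball x (t * \<rho>)) (?p t y) = (indicator (ball x \<rho>) y :: ennreal)"
          using t by (simp add: indicator_def dist_norm norm_minus_commute)
        have ge: "norm (G (?p t y)) * norm (y - x)
            = t ^ DIM('a) * (norm (G (?p t y)) * norm (?p t y - x) * t powr (- n - 1))"
        proof -
          have c: "t * (t ^ DIM('a) * t powr (- n - 1)) = 1"
            using t by (simp add: n_def powr_diff powr_minus powr_realpow)
          have "t ^ DIM('a) * (norm (G (?p t y)) * norm (?p t y - x) * t powr (- n - 1))
              = (t * (t ^ DIM('a) * t powr (- n - 1))) * (norm (G (?p t y)) * norm (y - x))"
            using t by simp
          then show ?thesis by (simp only: c mult_1)
        qed
        have "ennreal (norm (G (?p t y)) * norm (y - x))
            = ennreal (t ^ DIM('a)) * ennreal (norm (G (?p t y)) * norm (?p t y - x) * t powr (- n - 1))"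
          unfolding ge using t by (intro ennreal_mult) auto
        moreover have "indicator {0<..1} t = (1 :: ennreal)" using t by simp
        ultimately show ?thesis by (simp only: e ind mult.assoc mult_1)
      qed
      then have "(\<integral>\<^sup>+y. ennreal (norm (G (?p t y)) * norm (y - x)) * indicator {0<..1} t
          * indicator (ball x \<rho>) y \<partial>lborel)
          = ennreal (t ^ DIM('a)) * (\<integral>\<^sup>+y. ?f t ((x - t *\<^sub>R x) + t *\<^sub>R y) \<partial>lborel)"
        by (simp add: nn_integral_cmult indicator_ball_eq)
      also have "\<dots> = ennreal (t ^ DIM('a)) * (ennreal (1 / \<bar>t\<bar> ^ DIM('a)) * (\<integral>\<^sup>+z. ?f t z \<partial>lborel))"
        using t by (subst nn_integral_affine) (simp_all add: indicator_ball_eq)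
      also have "\<dots> = (\<integral>\<^sup>+z. ?f t z \<partial>lborel)"
        using t by (simp add: mult.assoc[symmetric] ennreal_mult[symmetric])
      finally show ?thesis using True by simp
    qed simp
  qed
  also have "\<dots> = (\<integral>\<^sup>+z. \<integral>\<^sup>+t. ?f t z * indicator {0<..1} t \<partial>lborel \<partial>lborel)"
    by (rule lborel_pair.Fubini') (simp add: indicator_ball_eq)
  also have "\<dots> \<le> (\<integral>\<^sup>+z. ennreal (\<rho> ^ DIM('a) / n) *
      (ennreal (norm (G z) * norm (z - x) powr (1 - n)) * indicator (ball x \<rho>) z) \<partial>lborel)"
  proof (rule nn_integral_mono)
    fix z
    show "(\<integral>\<^sup>+t. ?f t z * indicator {0<..1} t \<partial>lborel) \<le> ennreal (\<rho> ^ DIM('a) / n) *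
      (ennreal (norm (G z) * norm (z - x) powr (1 - n)) * indicator (ball x \<rho>) z)" (is "?l \<le> ?r")
    proof (cases "z = x")
      case False
      let ?d = "norm (z - x)"
      have d: "0 < ?d" using False by simp
      have "?l \<le> (\<integral>\<^sup>+t. ennreal (norm (G z) * ?d) * indicator (ball x \<rho>) z *
          (ennreal (t powr (- n - 1)) * indicator {?d / \<rho>..} t) \<partial>lborel)"
      proof (rule nn_integral_mono)
        fix t :: real
        show "?f t z * indicator {0<..1} t \<le> ennreal (norm (G z) * ?d) * indicator (ball x \<rho>) z *
          (ennreal (t powr (- n - 1)) * indicator {?d / \<rho>..} t)"
        proof (cases "0 < t \<and> t \<le> 1 \<and> ?d < t * \<rho>")
          case True
          have "t * \<rho> \<le> \<rho>" using True \<open>0 < \<rho>\<close> by simp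
          then have "?d < \<rho>" using True by linarith
          moreover have "?d / \<rho> \<le> t" using True \<open>0 < \<rho>\<close> by (simp add: field_simps)
          ultimately show ?thesis using True
            by (simp add: indicator_def dist_norm norm_minus_commute ennreal_mult)
        qed (auto simp: indicator_def dist_norm norm_minus_commute)
      qed
      also have "\<dots> = ennreal (norm (G z) * ?d) * indicator (ball x \<rho>) z *
          ennreal ((?d / \<rho>) powr - n / n)"
        using d n \<open>0 < \<rho>\<close> by (simp add: nn_integral_cmult nn_integral_powr_atLeast)
      also have "\<dots> = ?r"
      proof -
        have "(?d / \<rho>) powr - n = ?d powr - n * \<rho> ^ DIM('a)"
          using d \<open>0 < \<rho>\<close> by (simp add: powr_divide powr_minus powr_realpow n_def field_simps)
        then have "norm (G z) * ?d * ((?d / \<rho>) powr - n / n)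
            = \<rho> ^ DIM('a) / n * (norm (G z) * (?d * ?d powr - n))"
          by (simp only:) (simp add: mult_ac)
        also have "\<dots> = \<rho> ^ DIM('a) / n * (norm (G z) * ?d powr (1 - n))"
          using powr_mult_base[of ?d "- n"] by (simp add: mult_ac)
        finally show ?thesis using n d \<open>0 < \<rho>\<close>
          by (cases "z \<in> ball x \<rho>") (simp_all add: ennreal_mult[symmetric])
      qed
      finally show ?thesis .
    qed simp
  qed
  also have "\<dots> = ennreal (\<rho> ^ DIM('a) / n) *
      (\<integral>\<^sup>+z\<in>ball x \<rho>. ennreal (norm (G z) * norm (z - x) powr (1 - n)) \<partial>lborel)"
    by (rule nn_integral_cmult) (simp add: indicator_ball_eq)
  finally show ?thesis by (simp add: n_def)
qed

section \<open>A three-factor Hoelder inequality\<close>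

lemma weighted_arith_geo_mean3:
  fixes a b c :: real
  assumes "0 < \<alpha>" "0 < \<beta>" "0 < \<gamma>" "\<alpha> + \<beta> + \<gamma> = 1" and "0 \<le> a" "0 \<le> b" "0 \<le> c"
  shows "a powr \<alpha> * b powr \<beta> * c powr \<gamma> \<le> \<alpha> * a + \<beta> * b + \<gamma> * c"
proof (cases "a = 0 \<or> b = 0 \<or> c = 0")
  case True
  then show ?thesis using assms by auto
next
  case False
  then have pos: "0 < a" "0 < b" "0 < c" using assms by auto
  define s where "s = \<beta> + \<gamma>"
  have s: "0 < s" "\<alpha> + s = 1" "\<beta> / s + \<gamma> / s = 1"
    using assms by (auto simp: s_def add_divide_distrib[symmetric])
  define w where "w = b powr (\<beta> / s) * c powr (\<gamma> / s)"
  have w: "0 < w" using pos by (simp add: w_def)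
  have "w powr s = b powr \<beta> * c powr \<gamma>"
    using pos s by (simp add: w_def powr_mult powr_powr)
  then have "a powr \<alpha> * b powr \<beta> * c powr \<gamma> = a powr \<alpha> * w powr s" by simp
  also have "\<dots> \<le> \<alpha> * a + s * w"
    using Youngs_inequality_0[of \<alpha> s a w] assms s pos w by simp
  also have "s * w \<le> s * (\<beta> / s * b + \<gamma> / s * c)"
    unfolding w_def using Youngs_inequality_0[of "\<beta> / s" "\<gamma> / s" b c] assms s pos by simp
  also have "\<dots> = \<beta> * b + \<gamma> * c" using s(1) by (simp add: distrib_left)
  finally show ?thesis by simp
qed

text \<open>Divide each factor by its bound and apply the weighted arithmetic-geometric mean inequality
  pointwise. Real upper bounds \<open>A\<close>, \<open>B\<close>, \<open>C\<close> in place of the integrals themselves make it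
  unnecessary to raise extended reals to real powers.\<close>

lemma nn_integral_Holder3:
  fixes F G H :: "'a \<Rightarrow> real"
  assumes [measurable]: "F \<in> borel_measurable M" "G \<in> borel_measurable M" "H \<in> borel_measurable M"
    and nonneg: "\<And>x. 0 \<le> F x" "\<And>x. 0 \<le> G x" "\<And>x. 0 \<le> H x"
    and weights: "0 < \<alpha>" "0 < \<beta>" "0 < \<gamma>" "\<alpha> + \<beta> + \<gamma> = 1"
    and pos: "0 < A" "0 < B" "0 < C"
    and bounds: "(\<integral>\<^sup>+x. ennreal (F x) \<partial>M) \<le> ennreal A" "(\<integral>\<^sup>+x. ennreal (G x) \<partial>M) \<le> ennreal B"
      "(\<integral>\<^sup>+x. ennreal (H x) \<partial>M) \<le> ennreal C"
  shows "(\<integral>\<^sup>+x. ennreal (F x powr \<alpha> * G x powr \<beta> * H x powr \<gamma>) \<partial>M)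
    \<le> ennreal (A powr \<alpha> * B powr \<beta> * C powr \<gamma>)"
proof -
  define N where "N = A powr \<alpha> * B powr \<beta> * C powr \<gamma>"
  have N: "0 < N" using pos by (simp add: N_def)
  have *: "F x powr \<alpha> * G x powr \<beta> * H x powr \<gamma>
      \<le> N * \<alpha> / A * F x + N * \<beta> / B * G x + N * \<gamma> / C * H x" for x
  proof -
    have "F x powr \<alpha> * G x powr \<beta> * H x powr \<gamma>
        = N * ((F x / A) powr \<alpha> * (G x / B) powr \<beta> * (H x / C) powr \<gamma>)"
      using pos nonneg by (simp add: N_def powr_divide)
    also have "\<dots> \<le> N * (\<alpha> * (F x / A) + \<beta> * (G x / B) + \<gamma> * (H x / C))"
      using N pos nonneg weights by (intro mult_left_mono weighted_arith_geo_mean3) auto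
    finally show ?thesis by (simp add: algebra_simps)
  qed
  have "(\<integral>\<^sup>+x. ennreal (F x powr \<alpha> * G x powr \<beta> * H x powr \<gamma>) \<partial>M)
      \<le> (\<integral>\<^sup>+x. ennreal (N * \<alpha> / A * F x + N * \<beta> / B * G x + N * \<gamma> / C * H x) \<partial>M)"
    by (intro nn_integral_mono ennreal_leI *)
  also have "\<dots> = (\<integral>\<^sup>+x. ennreal (N * \<alpha> / A) * ennreal (F x) + ennreal (N * \<beta> / B) * ennreal (G x)
      + ennreal (N * \<gamma> / C) * ennreal (H x) \<partial>M)"
    using N pos nonneg weights by (simp add: ennreal_mult[symmetric] ennreal_plus[symmetric] del: ennreal_plus)
  also have "\<dots> = ennreal (N * \<alpha> / A) * (\<integral>\<^sup>+x. ennreal (F x) \<partial>M)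
      + ennreal (N * \<beta> / B) * (\<integral>\<^sup>+x. ennreal (G x) \<partial>M) + ennreal (N * \<gamma> / C) * (\<integral>\<^sup>+x. ennreal (H x) \<partial>M)"
    by (simp add: nn_integral_add nn_integral_cmult)
  also have "\<dots> \<le> ennreal (N * \<alpha> / A) * ennreal A + ennreal (N * \<beta> / B) * ennreal B
      + ennreal (N * \<gamma> / C) * ennreal C"
    by (intro add_mono mult_left_mono bounds) auto
  also have "\<dots> = ennreal (N * (\<alpha> + \<beta> + \<gamma>))"
    using N pos weights(1-3)
    by (simp add: ennreal_mult[symmetric] ennreal_plus[symmetric] distrib_left del: ennreal_plus)
  finally show ?thesis by (simp add: weights(4) N_def)
qed

section \<open>The weighted estimate for smooth functions\<close>

lemma nn_integral_indicat_real:
  "(\<integral>\<^sup>+z. ennreal (f z * indicat_real A z) \<partial>M) = (\<integral>\<^sup>+z\<in>A. ennreal (f z) \<partial>M)"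
  by (intro nn_integral_cong) (simp add: indicator_def)

text \<open>Young's convolution inequality in pointwise form. With \<open>k z = 1 / |z - x|\<close>, split
  \<open>h k = (h\<^sup>2 k) powr (1/q) * (h\<^sup>2) powr (1/2 - 1/q) * (k powr (2 - 2/q)) powr (1/2)\<close>
  and apply Hoelder's inequality. The last factor is subcritical in the plane, and
  its integral is at most \<open>\<pi> q \<rho> powr (2/q)\<close>; raised to the power \<open>q/2\<close> it yields
  \<open>(\<pi> q) powr (q/2) * \<rho>\<close>, hence a growth of order \<open>sqrt q\<close> after taking \<open>q\<close>-th roots. The first
  factor is kept as an integral over \<open>z\<close>, to be integrated in \<open>x\<close> later.\<close>

lemma Riesz_potential_powr_bound:
  fixes h :: "real^2 \<Rightarrow> real"
  assumes [measurable]: "h \<in> borel_measurable borel" and h: "\<And>z. 0 \<le> h z"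
    and "2 < q" "0 < \<rho>" "0 < E" "0 \<le> a"
    and E: "(\<integral>\<^sup>+z\<in>ball x \<rho>. ennreal ((h z)\<^sup>2) \<partial>lborel) \<le> ennreal E"
    and a: "ennreal a \<le> (\<integral>\<^sup>+z\<in>ball x \<rho>. ennreal (h z * norm (z - x) powr - 1) \<partial>lborel)"
  shows "ennreal (a powr q) \<le> ennreal ((pi * q) powr (q / 2) * E powr (q / 2 - 1) * \<rho>) *
    (\<integral>\<^sup>+z\<in>ball x \<rho>. ennreal ((h z)\<^sup>2 * norm (z - x) powr - 1) \<partial>lborel)"
proof -
  let ?k = "\<lambda>z. norm (z - x)"
  let ?i = "\<lambda>z. indicat_real (ball x \<rho>) z"
  define M where "M = (\<integral>\<^sup>+z\<in>ball x \<rho>. ennreal ((h z)\<^sup>2 * ?k z powr - 1) \<partial>lborel)"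
  define K where "K = pi * q * \<rho> powr (2 / q)"
  define c where "c = (pi * q) powr (q / 2) * E powr (q / 2 - 1) * \<rho>"
  have c: "0 < c" using assms by (simp add: c_def)
  have K: "0 < K" using assms by (simp add: K_def)
  have intK: "(\<integral>\<^sup>+z\<in>ball x \<rho>. ennreal (?k z powr - (2 - 2 / q)) \<partial>lborel) \<le> ennreal K"
    using nn_integral_ball_norm_powr[of "2 - 2 / q" \<rho> x] assms
    by (simp add: K_def unit_ball_vol_2 field_simps)
  show ?thesis
  proof (cases M)
    case top
    then show ?thesis using c unfolding M_def[symmetric] c_def[symmetric]
      by (simp add: ennreal_mult_top)
  next
    case (real m)
    \<comment> \<open>Hoelder's inequality above needs positive bounds, and \<open>m\<close> may vanish.\<close>
    have *: "a powr q \<le> c * (m + e)" if "0 < e" for e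
    proof -
      have fac: "h z * ?k z powr - 1 * ?i z = ((h z)\<^sup>2 * ?k z powr - 1 * ?i z) powr (1 / q) *
          ((h z)\<^sup>2 * ?i z) powr (1 / 2 - 1 / q) * (?k z powr - (2 - 2 / q) * ?i z) powr (1 / 2)" for z
      proof (cases "h z = 0 \<or> z = x \<or> z \<notin> ball x \<rho>")
        case False
        then have p: "0 < h z" "0 < ?k z" "?i z = 1" using h[of z] by auto
        have "((h z)\<^sup>2 * ?k z powr - 1) powr (1 / q) * ((h z)\<^sup>2) powr (1 / 2 - 1 / q)
            * (?k z powr - (2 - 2 / q)) powr (1 / 2)
          = ((h z powr 2) powr (1 / q) * (h z powr 2) powr (1 / 2 - 1 / q)) *
            ((?k z powr - 1) powr (1 / q) * (?k z powr - (2 - 2 / q)) powr (1 / 2))"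
          using p by (simp add: powr_mult powr_divide)
        also have "\<dots> = h z powr 1 * ?k z powr - 1"
        proof -
          have "2 * (1 / q) + 2 * (1 / 2 - 1 / q) = 1" "- 1 * (1 / q) + - (2 - 2 / q) * (1 / 2) = - 1"
            by (simp_all add: algebra_simps)
          then show ?thesis by (simp only: powr_powr powr_add[symmetric])
        qed
        finally show ?thesis using p by simp
      qed auto
      have "ennreal a \<le> (\<integral>\<^sup>+z. ennreal (h z * ?k z powr - 1 * ?i z) \<partial>lborel)"
        using a by (simp only: nn_integral_indicat_real)
      also have "\<dots> = (\<integral>\<^sup>+z. ennreal (((h z)\<^sup>2 * ?k z powr - 1 * ?i z) powr (1 / q) *
          ((h z)\<^sup>2 * ?i z) powr (1 / 2 - 1 / q) * (?k z powr - (2 - 2 / q) * ?i z) powr (1 / 2)) \<partial>lborel)"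
        by (simp only: fac)
      also have "\<dots> \<le> ennreal ((m + e) powr (1 / q) * E powr (1 / 2 - 1 / q) * K powr (1 / 2))"
      proof (rule nn_integral_Holder3)
        show "(\<lambda>z. (h z)\<^sup>2 * ?k z powr - 1 * ?i z) \<in> borel_measurable lborel"
          "(\<lambda>z. (h z)\<^sup>2 * ?i z) \<in> borel_measurable lborel"
          "(\<lambda>z. ?k z powr - (2 - 2 / q) * ?i z) \<in> borel_measurable lborel"
          by (simp_all add: indicator_ball_eq)
        show "(\<integral>\<^sup>+z. ennreal ((h z)\<^sup>2 * ?k z powr - 1 * ?i z) \<partial>lborel) \<le> ennreal (m + e)"
          using real that unfolding nn_integral_indicat_real M_def[symmetric] by (simp add: ennreal_leI)
        show "(\<integral>\<^sup>+z. ennreal ((h z)\<^sup>2 * ?i z) \<partial>lborel) \<le> ennreal E"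
          using E by (simp only: nn_integral_indicat_real)
        show "(\<integral>\<^sup>+z. ennreal (?k z powr - (2 - 2 / q) * ?i z) \<partial>lborel) \<le> ennreal K"
          using intK by (simp only: nn_integral_indicat_real)
      qed (use assms real that K in \<open>auto simp: field_simps\<close>)
      finally have "a \<le> (m + e) powr (1 / q) * E powr (1 / 2 - 1 / q) * K powr (1 / 2)"
        by simp
      then have "a powr q \<le> ((m + e) powr (1 / q) * E powr (1 / 2 - 1 / q) * K powr (1 / 2)) powr q"
        using assms by (intro powr_mono2) auto
      also have "\<dots> = (m + e) * E powr (q / 2 - 1) * K powr (q / 2)"
        using assms real that K by (simp add: powr_mult powr_powr left_diff_distrib)
      also have "K powr (q / 2) = (pi * q) powr (q / 2) * \<rho>"
        using assms by (simp add: K_def powr_mult powr_powr)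
      finally show ?thesis by (simp add: c_def mult_ac)
    qed
    have "a powr q \<le> c * m + e" if "0 < e" for e
      using *[of "e / c"] that c by (simp add: distrib_left)
    then have "a powr q \<le> c * m" by (rule field_le_epsilon)
    then show ?thesis
      unfolding M_def[symmetric] c_def[symmetric] using real c by (simp add: ennreal_mult[symmetric])
  qed
qed

text \<open>The mean of \<open>|\<phi>|\<close> over the ball is absorbed into the potential as well, since \<open>|z - x| < \<rho>\<close>
  and \<open>\<delta> z \<le> 3 \<rho>\<close> give \<open>1 \<le> 3 \<rho>\<^sup>2 / (\<delta> z |z - x|)\<close>. Thus a single potential, of the function
  whose square is comparable to the energy density, dominates \<open>\<phi>\<close>. Comparing with the area
  \<open>\<pi> \<rho>\<^sup>2\<close> of the ball and using \<open>3 < \<pi>\<close> gives the constant 1.\<close>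

lemma abs_le_Riesz_potential:
  fixes \<phi> :: "real^2 \<Rightarrow> real"
  assumes der: "\<And>z. (\<phi> has_derivative (\<lambda>v. G z \<bullet> v)) (at z)" and cont: "continuous_on UNIV G"
    and "0 < \<rho>" and \<delta>[measurable]: "\<delta> \<in> borel_measurable borel"
    and bnd: "\<And>z. z \<in> ball x \<rho> \<Longrightarrow> 0 < \<delta> z \<and> \<delta> z \<le> 3 * \<rho>"
  shows "ennreal \<bar>\<phi> x\<bar> \<le>
    (\<integral>\<^sup>+z\<in>ball x \<rho>. ennreal ((norm (G z) + \<bar>\<phi> z\<bar> / \<delta> z) * norm (z - x) powr - 1) \<partial>lborel)"
    (is "_ \<le> ?J")
proof -
  have [measurable]: "G \<in> borel_measurable borel"
    using cont by (rule borel_measurable_continuous_onI)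
  have [measurable]: "\<phi> \<in> borel_measurable borel"
    using der by (intro borel_measurable_continuous_onI continuous_at_imp_continuous_on ballI has_derivative_continuous) auto
  have "ennreal (pi * \<rho>\<^sup>2) * ennreal \<bar>\<phi> x\<bar> = (\<integral>\<^sup>+y\<in>ball x \<rho>. ennreal \<bar>\<phi> x\<bar> \<partial>lborel)"
    using \<open>0 < \<rho>\<close> by (simp add: nn_integral_cmult_indicator emeasure_ball unit_ball_vol_2 mult.commute)
  also have "\<dots> \<le> (\<integral>\<^sup>+y. ennreal \<bar>\<phi> y\<bar> * indicator (ball x \<rho>) y
      + ennreal \<bar>\<phi> y - \<phi> x\<bar> * indicator (ball x \<rho>) y \<partial>lborel)"
    by (intro nn_integral_mono) (auto simp: indicator_def ennreal_plus[symmetric] simp del: ennreal_plus intro!: ennreal_leI)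
  also have "\<dots> = (\<integral>\<^sup>+y\<in>ball x \<rho>. ennreal \<bar>\<phi> y\<bar> \<partial>lborel) + (\<integral>\<^sup>+y\<in>ball x \<rho>. ennreal \<bar>\<phi> y - \<phi> x\<bar> \<partial>lborel)"
    by (rule nn_integral_add) (simp_all add: indicator_ball_eq)
  also have "\<dots> \<le> (\<integral>\<^sup>+y\<in>ball x \<rho>. ennreal \<bar>\<phi> y\<bar> \<partial>lborel) +
      ennreal (\<rho>\<^sup>2 / 2) * (\<integral>\<^sup>+z\<in>ball x \<rho>. ennreal (norm (G z) * norm (z - x) powr - 1) \<partial>lborel)"
    using nn_integral_increment_le_Riesz_potential[OF der cont \<open>0 < \<rho>\<close>, of x]
    by (intro add_left_mono) simp
  also have "\<dots> = (\<integral>\<^sup>+z. ennreal \<bar>\<phi> z\<bar> * indicator (ball x \<rho>) z +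
      ennreal (\<rho>\<^sup>2 / 2) * (ennreal (norm (G z) * norm (z - x) powr - 1) * indicator (ball x \<rho>) z) \<partial>lborel)"
    by (simp add: nn_integral_add nn_integral_cmult indicator_ball_eq)
  also have "\<dots> \<le> (\<integral>\<^sup>+z. ennreal (pi * \<rho>\<^sup>2) *
      (ennreal ((norm (G z) + \<bar>\<phi> z\<bar> / \<delta> z) * norm (z - x) powr - 1) * indicator (ball x \<rho>) z) \<partial>lborel)"
  proof (rule nn_integral_mono_AE, use AE_lborel_singleton[of x] in eventually_elim)
    fix z assume "z \<noteq> x"
    show "ennreal \<bar>\<phi> z\<bar> * indicator (ball x \<rho>) z +
      ennreal (\<rho>\<^sup>2 / 2) * (ennreal (norm (G z) * norm (z - x) powr - 1) * indicator (ball x \<rho>) z)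
      \<le> ennreal (pi * \<rho>\<^sup>2) *
      (ennreal ((norm (G z) + \<bar>\<phi> z\<bar> / \<delta> z) * norm (z - x) powr - 1) * indicator (ball x \<rho>) z)"
    proof (cases "z \<in> ball x \<rho>")
      case True
      let ?k = "norm (z - x) powr - 1"
      have d: "0 < norm (z - x)" "norm (z - x) \<le> \<rho>"
        using True \<open>z \<noteq> x\<close> by (auto simp: dist_norm norm_minus_commute)
      have k: "1 \<le> \<rho> * ?k" using d by (simp add: powr_minus_divide)
      have \<delta>z: "0 < \<delta> z" "\<delta> z \<le> 3 * \<rho>" using bnd[OF True] by auto
      have "\<bar>\<phi> z\<bar> = \<delta> z * 1 * (\<bar>\<phi> z\<bar> / \<delta> z)" using \<delta>z by simp
      also have "\<dots> \<le> (3 * \<rho>) * (\<rho> * ?k) * (\<bar>\<phi> z\<bar> / \<delta> z)"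
        using \<delta>z k \<open>0 < \<rho>\<close> by (intro mult_right_mono mult_mono) auto
      also have "\<dots> = 3 * \<rho>\<^sup>2 * (\<bar>\<phi> z\<bar> / \<delta> z * ?k)"
        by (simp add: power2_eq_square mult_ac)
      also have "\<dots> \<le> pi * \<rho>\<^sup>2 * (\<bar>\<phi> z\<bar> / \<delta> z * ?k)"
        using \<delta>z pi_gt3 by (intro mult_right_mono) auto
      finally have 1: "\<bar>\<phi> z\<bar> \<le> pi * \<rho>\<^sup>2 * (\<bar>\<phi> z\<bar> / \<delta> z * ?k)" .
      have 2: "\<rho>\<^sup>2 / 2 * (norm (G z) * ?k) \<le> pi * \<rho>\<^sup>2 * (norm (G z) * ?k)"
        using pi_gt3 \<open>0 < \<rho>\<close> by (intro mult_right_mono) auto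
      have "\<bar>\<phi> z\<bar> + \<rho>\<^sup>2 / 2 * (norm (G z) * ?k) \<le> pi * \<rho>\<^sup>2 * ((norm (G z) + \<bar>\<phi> z\<bar> / \<delta> z) * ?k)"
        using 1 2 unfolding distrib_left distrib_right by linarith
      then have "ennreal (\<bar>\<phi> z\<bar> + \<rho>\<^sup>2 / 2 * (norm (G z) * ?k))
          \<le> ennreal (pi * \<rho>\<^sup>2 * ((norm (G z) + \<bar>\<phi> z\<bar> / \<delta> z) * ?k))"
        by (rule ennreal_leI)
      also have "\<dots> = ennreal (pi * \<rho>\<^sup>2) * ennreal ((norm (G z) + \<bar>\<phi> z\<bar> / \<delta> z) * ?k)"
        by (rule ennreal_mult') simp
      also have "ennreal (\<bar>\<phi> z\<bar> + \<rho>\<^sup>2 / 2 * (norm (G z) * ?k))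
          = ennreal \<bar>\<phi> z\<bar> + ennreal (\<rho>\<^sup>2 / 2) * ennreal (norm (G z) * ?k)"
        by (subst ennreal_mult'[symmetric], simp, subst ennreal_plus, auto)
      finally show ?thesis using True by (simp del: ennreal_plus)
    qed simp
  qed
  also have "\<dots> = ennreal (pi * \<rho>\<^sup>2) * ?J"
    by (rule nn_integral_cmult) (simp add: indicator_ball_eq)
  finally show ?thesis
    using \<open>0 < \<rho>\<close> by (subst (asm) ennreal_mult_le_mult_iff) auto
qed

text \<open>The weight \<open>\<delta>\<close> is Lipschitz, so it is comparable to \<open>\<delta> x\<close> on \<open>ball x (\<delta> x / 2)\<close>. Integrating
  the pointwise bound against \<open>1 / \<delta>\<^sup>2\<close> and exchanging the integrals, each \<open>z\<close> receives
  \<open>h(z)\<^sup>2\<close> times the integral of \<open>1 / (\<delta> x |x - z|)\<close> over those \<open>x\<close> whose ball contains \<open>z\<close>.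
  All such \<open>x\<close> lie in \<open>ball z (\<delta> z)\<close> and satisfy \<open>\<delta> z \<le> 3/2 * \<delta> x\<close>, so this integral is
  at most \<open>3 \<pi>\<close>, whatever \<open>z\<close> is. The integral over \<open>x\<close> thus plays the role of the sum
  over a Whitney covering. The set \<open>T\<close> may be smaller than the set where \<open>\<delta>\<close> is positive;
  the passage to the limit relies on this.\<close>

lemma weighted_Lq_estimate:
  fixes \<phi> \<delta> :: "real^2 \<Rightarrow> real"
  assumes der: "\<And>z. (\<phi> has_derivative (\<lambda>v. G z \<bullet> v)) (at z)" and cont: "continuous_on UNIV G"
    and lip: "1-lipschitz_on UNIV \<delta>" and \<delta>0: "\<And>z. 0 \<le> \<delta> z"
    and [measurable]: "S \<in> sets borel" "T \<in> sets borel"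
    and ST: "\<And>x. x \<in> S \<Longrightarrow> 0 < \<delta> x \<and> ball x (\<delta> x / 2) \<subseteq> T"
    and "2 < q" "0 < E"
    and E: "(\<integral>\<^sup>+z\<in>T. ennreal ((norm (G z))\<^sup>2 + (\<phi> z)\<^sup>2 / (\<delta> z)\<^sup>2) \<partial>lborel) \<le> ennreal E"
  shows "(\<integral>\<^sup>+x\<in>S. ennreal (\<bar>\<phi> x\<bar> powr q / (\<delta> x)\<^sup>2) \<partial>lborel)
    \<le> ennreal (3 * pi * (2 * pi * q * E) powr (q / 2))"
proof -
  have [measurable]: "G \<in> borel_measurable borel"
    using cont by (rule borel_measurable_continuous_onI)
  have [measurable]: "\<phi> \<in> borel_measurable borel"
    using der by (intro borel_measurable_continuous_onI continuous_at_imp_continuous_on ballI has_derivative_continuous) auto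
  have [measurable]: "\<delta> \<in> borel_measurable borel"
    using lip by (intro borel_measurable_continuous_onI lipschitz_on_continuous_on)
  have lip': "\<delta> x \<le> \<delta> z + dist x z" for x z
    using lipschitz_onD[OF lip, of x z] by (auto simp: dist_real_def)
  define h where "h = (\<lambda>z. norm (G z) + \<bar>\<phi> z\<bar> / \<delta> z)"
  have [measurable]: "h \<in> borel_measurable borel" unfolding h_def by measurable
  have h: "0 \<le> h z" for z by (simp add: h_def \<delta>0)
  have "ennreal ((h z)\<^sup>2) \<le> ennreal 2 * ennreal ((norm (G z))\<^sup>2 + (\<phi> z)\<^sup>2 / (\<delta> z)\<^sup>2)" for z
  proof -
    have "(h z)\<^sup>2 \<le> 2 * ((norm (G z))\<^sup>2 + (\<bar>\<phi> z\<bar> / \<delta> z)\<^sup>2)"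
      unfolding h_def using sum_squares_bound[of "norm (G z)" "\<bar>\<phi> z\<bar> / \<delta> z"]
      by (simp add: power2_sum)
    then have "(h z)\<^sup>2 \<le> 2 * ((norm (G z))\<^sup>2 + (\<phi> z)\<^sup>2 / (\<delta> z)\<^sup>2)"
      by (simp add: power_divide)
    then show ?thesis by (subst ennreal_mult'[symmetric]) (simp_all only: ennreal_leI zero_le_numeral)
  qed
  then have "(\<integral>\<^sup>+z\<in>T. ennreal ((h z)\<^sup>2) \<partial>lborel) \<le>
      (\<integral>\<^sup>+z. ennreal 2 * (ennreal ((norm (G z))\<^sup>2 + (\<phi> z)\<^sup>2 / (\<delta> z)\<^sup>2) * indicator T z) \<partial>lborel)"
    by (intro nn_integral_mono) (auto simp: indicator_def simp del: ennreal_numeral)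
  also have "\<dots> = ennreal 2 * (\<integral>\<^sup>+z\<in>T. ennreal ((norm (G z))\<^sup>2 + (\<phi> z)\<^sup>2 / (\<delta> z)\<^sup>2) \<partial>lborel)"
    by (rule nn_integral_cmult) simp
  also have "\<dots> \<le> ennreal 2 * ennreal E" by (intro mult_left_mono E) simp
  also have "\<dots> = ennreal (2 * E)" by (rule ennreal_mult'[symmetric]) simp
  finally have Eh: "(\<integral>\<^sup>+z\<in>T. ennreal ((h z)\<^sup>2) \<partial>lborel) \<le> ennreal (2 * E)" .
  \<comment> \<open>With \<open>\<rho> = \<delta> x / 2\<close>, the bound for \<open>|\<phi> x| powr q\<close> divided by \<open>(\<delta> x)\<^sup>2\<close> leaves the factor
      \<open>c / (2 * \<delta> x)\<close>, which explains \<open>c / 2\<close> below.\<close>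
  define c where "c = (pi * q) powr (q / 2) * (2 * E) powr (q / 2 - 1)"
  have c: "0 \<le> c" by (simp add: c_def)
  let ?f = "\<lambda>x z. ennreal (c / 2) * (ennreal ((h z)\<^sup>2) * (ennreal (norm (z - x) powr - 1) *
      ennreal (1 / \<delta> x) * indicator S x * indicator (ball x (\<delta> x / 2)) z))"
  have "(\<integral>\<^sup>+x\<in>S. ennreal (\<bar>\<phi> x\<bar> powr q / (\<delta> x)\<^sup>2) \<partial>lborel) \<le> (\<integral>\<^sup>+x. (\<integral>\<^sup>+z. ?f x z \<partial>lborel) \<partial>lborel)"
  proof (rule nn_integral_mono)
    fix x
    show "ennreal (\<bar>\<phi> x\<bar> powr q / (\<delta> x)\<^sup>2) * indicator S x \<le> (\<integral>\<^sup>+z. ?f x z \<partial>lborel)"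
    proof (cases "x \<in> S")
      case True
      define \<rho> where "\<rho> = \<delta> x / 2"
      have \<rho>: "0 < \<rho>" "ball x \<rho> \<subseteq> T" "\<delta> x = 2 * \<rho>" using ST[OF True] by (auto simp: \<rho>_def)
      have bnd: "0 < \<delta> z \<and> \<delta> z \<le> 3 * \<rho>" if "z \<in> ball x \<rho>" for z
        using that lip'[of x z] lip'[of z x] \<rho> by (auto simp: dist_commute)
      have "ennreal (\<bar>\<phi> x\<bar> powr q) \<le> ennreal (c * \<rho>) *
          (\<integral>\<^sup>+z\<in>ball x \<rho>. ennreal ((h z)\<^sup>2 * norm (z - x) powr - 1) \<partial>lborel)"
        unfolding c_def
      proof (rule Riesz_potential_powr_bound)
        show "(\<integral>\<^sup>+z\<in>ball x \<rho>. ennreal ((h z)\<^sup>2) \<partial>lborel) \<le> ennreal (2 * E)"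
          using \<rho> by (intro order_trans[OF nn_set_integral_set_mono Eh]) auto
        show "ennreal \<bar>\<phi> x\<bar> \<le> (\<integral>\<^sup>+z\<in>ball x \<rho>. ennreal (h z * norm (z - x) powr - 1) \<partial>lborel)"
          unfolding h_def using der cont \<rho> bnd by (intro abs_le_Riesz_potential) auto
      qed (use assms h \<rho> in auto)
      then have "ennreal (1 / (\<delta> x)\<^sup>2) * ennreal (\<bar>\<phi> x\<bar> powr q) \<le> ennreal (1 / (\<delta> x)\<^sup>2) * (ennreal (c * \<rho>) *
          (\<integral>\<^sup>+z\<in>ball x \<rho>. ennreal ((h z)\<^sup>2 * norm (z - x) powr - 1) \<partial>lborel))"
        by (rule mult_left_mono) simp
      also have "\<dots> = ennreal (c / 2 * (1 / \<delta> x)) *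
          (\<integral>\<^sup>+z\<in>ball x \<rho>. ennreal ((h z)\<^sup>2 * norm (z - x) powr - 1) \<partial>lborel)"
        using c \<rho> by (simp add: mult.assoc[symmetric] ennreal_mult[symmetric])
          (simp add: power2_eq_square)
      also have "\<dots> = (\<integral>\<^sup>+z. ennreal (c / 2 * (1 / \<delta> x)) *
          (ennreal ((h z)\<^sup>2 * norm (z - x) powr - 1) * indicator (ball x \<rho>) z) \<partial>lborel)"
        by (rule nn_integral_cmult[symmetric]) (simp add: indicator_ball_eq)
      also have "\<dots> = (\<integral>\<^sup>+z. ?f x z \<partial>lborel)"
      proof -
        have "indicator S x = (1::ennreal)" using True by simp
        moreover have "ennreal (c / 2 * (1 / \<delta> x)) = ennreal (c / 2) * ennreal (1 / \<delta> x)"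
          using c \<rho> by (intro ennreal_mult) auto
        moreover have "ennreal ((h z)\<^sup>2 * norm (z - x) powr - 1)
            = ennreal ((h z)\<^sup>2) * ennreal (norm (z - x) powr - 1)" for z
          by (intro ennreal_mult) auto
        ultimately show ?thesis by (simp only: \<rho>_def[symmetric] mult_1_left mult_1_right mult_ac)
      qed
      finally show ?thesis using True by (simp add: ennreal_mult'[symmetric])
    qed simp
  qed
  also have "\<dots> = (\<integral>\<^sup>+z. (\<integral>\<^sup>+x. ?f x z \<partial>lborel) \<partial>lborel)"
    by (rule lborel_pair.Fubini') (simp add: indicator_ball_eq)
  also have "\<dots> \<le> (\<integral>\<^sup>+z. ennreal (c / 2 * (3 * pi)) * (ennreal ((h z)\<^sup>2) * indicator T z) \<partial>lborel)"
  proof (rule nn_integral_mono)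
    fix z
    let ?g = "\<lambda>x. ennreal (norm (z - x) powr - 1) * ennreal (1 / \<delta> x) * indicator S x * indicator (ball x (\<delta> x / 2)) z"
    have "(\<integral>\<^sup>+x. ?g x \<partial>lborel) \<le> ennreal (3 * pi) * indicator T z"
    proof (cases "z \<in> T \<and> 0 < \<delta> z")
      case True
      have "?g x \<le> ennreal (3 / (2 * \<delta> z)) * (ennreal (norm (x - z) powr - 1) * indicator (ball z (\<delta> z)) x)" for x
      proof (cases "x \<in> S \<and> z \<in> ball x (\<delta> x / 2)")
        case in_S: True
        then have "0 < \<delta> x" and d: "dist x z < \<delta> x / 2" using ST by auto
        have "dist x z < \<delta> z" "\<delta> z \<le> 3 / 2 * \<delta> x"
          using d lip'[of x z] lip'[of z x] by (auto simp: dist_commute)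
        then have "indicator S x = (1::ennreal)" "indicator (ball x (\<delta> x / 2)) z = (1::ennreal)"
          "indicator (ball z (\<delta> z)) x = (1::ennreal)"
          using in_S by (auto simp: dist_commute)
        moreover have "1 / \<delta> x \<le> 3 / (2 * \<delta> z)"
          using \<open>\<delta> z \<le> 3 / 2 * \<delta> x\<close> True \<open>0 < \<delta> x\<close> by (simp add: field_simps)
        then have "ennreal (norm (x - z) powr - 1) * ennreal (1 / \<delta> x)
            \<le> ennreal (norm (x - z) powr - 1) * ennreal (3 / (2 * \<delta> z))"
          by (intro mult_left_mono ennreal_leI) auto
        ultimately show ?thesis
          by (simp only: norm_minus_commute[of z x] mult_1_right mult.commute[of "ennreal (3 / _)"])
      qed auto
      then have "(\<integral>\<^sup>+x. ?g x \<partial>lborel) \<le>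
          (\<integral>\<^sup>+x. ennreal (3 / (2 * \<delta> z)) * (ennreal (norm (x - z) powr - 1) * indicator (ball z (\<delta> z)) x) \<partial>lborel)"
        by (rule nn_integral_mono)
      also have "\<dots> = ennreal (3 / (2 * \<delta> z)) * (\<integral>\<^sup>+x\<in>ball z (\<delta> z). ennreal (norm (x - z) powr - 1) \<partial>lborel)"
        by (rule nn_integral_cmult) (simp add: indicator_ball_eq)
      also have "\<dots> \<le> ennreal (3 / (2 * \<delta> z)) * ennreal (2 * pi * \<delta> z)"
        using nn_integral_ball_norm_powr[of 1 "\<delta> z" z] True
        by (intro mult_left_mono) (simp_all add: unit_ball_vol_2)
      also have "\<dots> = ennreal (3 * pi)" using True by (simp add: ennreal_mult[symmetric])
      finally show ?thesis using True by simp
    next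
      case False
      have "?g x = 0" for x
      proof (cases "x \<in> S \<and> z \<in> ball x (\<delta> x / 2)")
        case True
        then have "z \<in> T" "0 < \<delta> z" using ST[of x] lip'[of x z] by auto
        with False show ?thesis by simp
      qed auto
      then have "(\<integral>\<^sup>+x. ?g x \<partial>lborel) = (\<integral>\<^sup>+(x::real^2). 0 \<partial>lborel)" by (simp only:)
      then show ?thesis by simp
    qed
    then have "ennreal (c / 2) * (ennreal ((h z)\<^sup>2) * (\<integral>\<^sup>+x. ?g x \<partial>lborel))
        \<le> ennreal (c / 2) * (ennreal ((h z)\<^sup>2) * (ennreal (3 * pi) * indicator T z))"
      by (intro mult_left_mono) auto
    also have "\<dots> = ennreal (c / 2 * (3 * pi)) * (ennreal ((h z)\<^sup>2) * indicator T z)"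
      using c by (subst ennreal_mult) (auto simp: mult_ac)
    also have "ennreal (c / 2) * (ennreal ((h z)\<^sup>2) * (\<integral>\<^sup>+x. ?g x \<partial>lborel)) = (\<integral>\<^sup>+x. ?f x z \<partial>lborel)"
      by (subst nn_integral_cmult[symmetric], simp add: indicator_ball_eq)+ simp
    finally show "(\<integral>\<^sup>+x. ?f x z \<partial>lborel) \<le> ennreal (c / 2 * (3 * pi)) * (ennreal ((h z)\<^sup>2) * indicator T z)" .
  qed
  also have "\<dots> = ennreal (c / 2 * (3 * pi)) * (\<integral>\<^sup>+z\<in>T. ennreal ((h z)\<^sup>2) \<partial>lborel)"
    by (rule nn_integral_cmult) simp
  also have "\<dots> \<le> ennreal (c / 2 * (3 * pi)) * ennreal (2 * E)"
    by (intro mult_left_mono Eh) simp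
  also have "\<dots> = ennreal (c / 2 * (3 * pi) * (2 * E))"
    using c \<open>0 < E\<close> by (intro ennreal_mult[symmetric]) auto
  also have "\<dots> \<le> ennreal (3 * pi * (2 * pi * q * E) powr (q / 2))"
  proof (rule ennreal_leI)
    let ?P = "(2 * pi * q * E) powr (q / 2)"
    have "c * (2 * E) = (pi * q) powr (q / 2) * (2 * E) powr (q / 2)"
      using \<open>0 < E\<close> powr_mult_base[of "2 * E" "q / 2 - 1"] by (simp only: c_def mult_ac) simp
    also have "\<dots> = (pi * q * (2 * E)) powr (q / 2)"
      using \<open>2 < q\<close> \<open>0 < E\<close> by (simp add: powr_mult)
    also have "pi * q * (2 * E) = 2 * pi * q * E" by simp
    finally have "c * (2 * E) = ?P" .
    moreover have "c / 2 * (3 * pi) * (2 * E) = c * (2 * E) / 2 * (3 * pi)" by simp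
    ultimately have "c / 2 * (3 * pi) * (2 * E) = ?P / 2 * (3 * pi)" by (simp only:)
    also have "\<dots> \<le> 3 * pi * ?P" by simp
    finally show "c / 2 * (3 * pi) * (2 * E) \<le> 3 * pi * ?P" .
  qed
  finally show ?thesis .
qed

section \<open>Boundary distance, test functions and measurability\<close>

lemma bdist_nonneg: "0 \<le> bdist \<Omega> x"
  by (simp add: bdist_def infdist_nonneg)

lemma bdist_lipschitz: "1-lipschitz_on UNIV (bdist \<Omega>)"
  by (rule lipschitz_onI) (auto simp: bdist_def dist_real_def infdist_triangle_abs)

lemma bdist_pos:
  assumes "open \<Omega>" "frontier \<Omega> \<noteq> {}" "x \<in> \<Omega>"
  shows "0 < bdist \<Omega> x"
  using assms infdist_pos_not_in_closed[of "frontier \<Omega>" x]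
  by (auto simp: bdist_def frontier_def interior_open)

text \<open>A segment that leaves \<open>\<Omega>\<close> meets the frontier, at a point no farther away than its end.\<close>

lemma ball_bdist_subset:
  assumes "x \<in> \<Omega>"
  shows "ball x (bdist \<Omega> x) \<subseteq> \<Omega>"
proof
  fix z assume z: "z \<in> ball x (bdist \<Omega> x)"
  show "z \<in> \<Omega>"
  proof (rule ccontr)
    assume "z \<notin> \<Omega>"
    then have "closed_segment x z \<inter> frontier \<Omega> \<noteq> {}"
      using \<open>x \<in> \<Omega>\<close> by (intro connected_Int_frontier) auto
    then obtain w where w: "w \<in> closed_segment x z" "w \<in> frontier \<Omega>" by auto
    then have "bdist \<Omega> x \<le> dist x w" by (simp add: bdist_def infdist_le)
    also have "\<dots> \<le> dist x z" using dist_in_closed_segment[OF w(1)] by (simp add: dist_commute)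
    finally show False using z by simp
  qed
qed

lemma test_function_has_derivative:
  assumes "\<phi> \<in> test_functions \<Omega>"
  shows "(\<phi> has_derivative (\<lambda>v. gradient \<phi> z \<bullet> v)) (at z)"
proof -
  have "Ck (Suc 0) \<phi>" using assms unfolding test_functions_def by blast
  then have "(\<phi> has_derivative frechet_derivative \<phi> (at z)) (at z)"
    by (simp add: frechet_derivative_works)
  moreover from this have lin: "linear (frechet_derivative \<phi> (at z))"
    by (rule has_derivative_linear)
  moreover have "frechet_derivative \<phi> (at z) v = gradient \<phi> z \<bullet> v" for v
  proof -
    have "frechet_derivative \<phi> (at z) v = frechet_derivative \<phi> (at z) (\<Sum>b\<in>Basis. (v \<bullet> b) *\<^sub>R b)"
      by (simp add: euclidean_representation)
    also have "\<dots> = (\<Sum>b\<in>Basis. (v \<bullet> b) * frechet_derivative \<phi> (at z) b)"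
      by (simp add: linear_sum[OF lin] linear_scale[OF lin])
    also have "\<dots> = gradient \<phi> z \<bullet> v"
      by (simp add: gradient_def inner_sum_left inner_commute[of v] mult.commute)
    finally show ?thesis .
  qed
  ultimately show ?thesis by (metis (no_types, lifting) ext)
qed

lemma continuous_on_gradient_test_function:
  assumes "\<phi> \<in> test_functions \<Omega>"
  shows "continuous_on UNIV (gradient \<phi>)"
proof -
  have "Ck (Suc 0) \<phi>" using assms unfolding test_functions_def by blast
  then show ?thesis
    unfolding gradient_def by (intro continuous_intros) auto
qed

text \<open>Needed for weak gradients, which are given as locally integrable functions only, with no
  separate measurability on \<open>\<Omega>\<close>: exhaust \<open>\<Omega>\<close> by compact sets.\<close>

lemma locally_integrable_imp_set_borel_measurable:
  assumes "open \<Omega>" "locally_integrable \<Omega> f"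
  shows "set_borel_measurable lebesgue \<Omega> f"
proof -
  obtain C :: "nat \<Rightarrow> 'a set" where C: "\<And>n. compact (C n)" "\<And>n. C n \<subseteq> \<Omega>"
    "\<And>K. \<lbrakk>compact K; K \<subseteq> \<Omega>\<rbrakk> \<Longrightarrow> \<exists>N. \<forall>n\<ge>N. K \<subseteq> C n"
    using open_Union_compact_subsets[OF \<open>open \<Omega>\<close>] by metis
  show ?thesis unfolding set_borel_measurable_def
  proof (rule borel_measurable_LIMSEQ_metric)
    show "(\<lambda>x. indicat_real (C n) x *\<^sub>R f x) \<in> borel_measurable lebesgue" for n
      using assms(2) C by (auto simp: locally_integrable_def set_integrable_def dest: borel_measurable_integrable)
    show "(\<lambda>n. indicat_real (C n) x *\<^sub>R f x) \<longlonglongrightarrow> indicat_real \<Omega> x *\<^sub>R f x" for x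
    proof (cases "x \<in> \<Omega>")
      case True
      then obtain N where "\<forall>n\<ge>N. {x} \<subseteq> C n" using C(3)[of "{x}"] by auto
      then have "\<forall>\<^sub>F n in sequentially. indicat_real (C n) x *\<^sub>R f x = indicat_real \<Omega> x *\<^sub>R f x"
        using True by (auto simp: eventually_sequentially intro!: exI[of _ N])
      then show ?thesis by (rule tendsto_eventually)
    next
      case False
      then have "indicat_real (C n) x = 0" for n using C(2)[of n] by (auto simp: indicator_def)
      then show ?thesis using False by simp
    qed
  qed
qed

section \<open>From test functions to the whole Sobolev space\<close>

lemma norm_sq_le_Peter_Paul:
  fixes a b :: "'a::real_inner"
  assumes "0 < \<eta>"
  shows "(norm a)\<^sup>2 \<le> (1 + \<eta>) * (norm b)\<^sup>2 + (1 + 1 / \<eta>) * (norm (b - a))\<^sup>2"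
proof -
  have "norm a \<le> norm b + norm (b - a)"
    using norm_triangle_ineq4[of b "b - a"] by simp
  then have "(norm a)\<^sup>2 \<le> (norm b + norm (b - a))\<^sup>2" by (rule power_mono) simp
  also have "\<dots> = (norm b)\<^sup>2 + (norm (b - a))\<^sup>2 + 2 * norm b * norm (b - a)" by (simp add: power2_sum)
  also have "2 * norm b * norm (b - a) \<le> \<eta> * (norm b)\<^sup>2 + 1 / \<eta> * (norm (b - a))\<^sup>2"
  proof -
    have "0 \<le> (\<eta> * norm b - norm (b - a))\<^sup>2 / \<eta>" using assms by simp
    also have "\<dots> = \<eta> * (norm b)\<^sup>2 + 1 / \<eta> * (norm (b - a))\<^sup>2 - 2 * norm b * norm (b - a)"
      using assms by (simp add: power2_eq_square field_simps)
    finally show ?thesis by simp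
  qed
  finally show ?thesis by (simp add: distrib_right)
qed

text \<open>Convergence in \<open>H\<^sup>1\<close> does not control \<open>u\<^sup>2 / \<delta>\<^sup>2\<close> near the frontier, because a Hardy inequality
  may fail. The estimate for \<open>S = {\<delta> \<ge> \<epsilon>}\<close>, however, only uses the energy on \<open>T = {\<delta> \<ge> \<epsilon>/2}\<close>,
  where the weight is at most \<open>4 / \<epsilon>\<^sup>2\<close>. There the weighted energies of the approximating test
  functions eventually drop below any \<open>E\<close> larger than the energy of \<open>u\<close>, and Fatou's lemma along an
  almost everywhere convergent subsequence gives the estimate for \<open>u\<close>, with a constant that does not
  depend on \<open>\<epsilon>\<close>.\<close>

lemma nn_integral_truncated_le_of_H1_0:
  fixes \<Omega> :: "(real^2) set"
  assumes \<Omega>: "open \<Omega>" "frontier \<Omega> \<noteq> {}" and u: "u \<in> H1_0 \<Omega>" and "2 < q" "0 < \<epsilon>"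
    and E: "(\<integral>\<^sup>+x\<in>\<Omega>. ennreal ((norm (weak_gradient \<Omega> u x))\<^sup>2 + (u x)\<^sup>2 / (bdist \<Omega> x)\<^sup>2) \<partial>lebesgue) < ennreal E"
  shows "(\<integral>\<^sup>+x\<in>{x \<in> \<Omega>. \<epsilon> \<le> bdist \<Omega> x}. ennreal (\<bar>u x\<bar> powr q / (bdist \<Omega> x)\<^sup>2) \<partial>lebesgue)
    \<le> ennreal (3 * pi * (2 * pi * q * E) powr (q / 2))"
proof -
  define \<delta> where "\<delta> = bdist \<Omega>"
  define g where "g = weak_gradient \<Omega> u"
  define S where "S = {x \<in> \<Omega>. \<epsilon> \<le> \<delta> x}"
  define T where "T = {x \<in> \<Omega>. \<epsilon> / 2 \<le> \<delta> x}"
  have lip: "1-lipschitz_on UNIV \<delta>" unfolding \<delta>_def by (rule bdist_lipschitz)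
  have [measurable]: "\<delta> \<in> borel_measurable borel"
    using lip by (intro borel_measurable_continuous_onI lipschitz_on_continuous_on)
  have [measurable]: "\<Omega> \<in> sets borel" using \<Omega> by simp
  have ST_borel[measurable]: "S \<in> sets borel" "T \<in> sets borel" unfolding S_def T_def by measurable
  have lborelD: "f \<in> borel_measurable lebesgue" if "f \<in> borel_measurable borel" for f :: "real^2 \<Rightarrow> 'b::topological_space"
    using that by (simp add: measurable_completion)
  have \<delta>0: "0 \<le> \<delta> x" for x by (simp add: \<delta>_def bdist_nonneg)
  have ST: "0 < \<delta> x \<and> ball x (\<delta> x / 2) \<subseteq> T" if "x \<in> S" for x
  proof
    show pos: "0 < \<delta> x" using that \<open>0 < \<epsilon>\<close> by (simp add: S_def)
    show "ball x (\<delta> x / 2) \<subseteq> T"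
    proof
      fix z assume z: "z \<in> ball x (\<delta> x / 2)"
      then have "z \<in> ball x (\<delta> x)" using pos by auto
      then have "z \<in> \<Omega>" using that ball_bdist_subset[of x \<Omega>] by (auto simp: S_def \<delta>_def)
      moreover have "\<delta> x \<le> \<delta> z + dist x z"
        using lipschitz_onD[OF lip, of x z] by (auto simp: dist_real_def)
      ultimately show "z \<in> T" using z that by (auto simp: T_def S_def)
    qed
  qed
  have "u \<in> H1 \<Omega>" using u by (simp add: H1_0_def)
  then have L2u: "L2_on \<Omega> u" and ex: "\<exists>g. is_weak_gradient \<Omega> u g" by (auto simp: H1_def)
  have "is_weak_gradient \<Omega> u g" unfolding g_def weak_gradient_def using ex by (rule someI_ex)
  then have mg[measurable]: "(\<lambda>x. indicat_real \<Omega> x *\<^sub>R g x) \<in> borel_measurable lebesgue"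
    using locally_integrable_imp_set_borel_measurable[OF \<Omega>(1)]
    by (auto simp: is_weak_gradient_def set_borel_measurable_def)
  have mu[measurable]: "(\<lambda>x. indicat_real \<Omega> x * u x) \<in> borel_measurable lebesgue"
    using L2u by (simp add: L2_on_def set_borel_measurable_def)
  have "\<exists>\<phi>\<in>test_functions \<Omega>. (\<integral>\<^sup>+x\<in>\<Omega>. ennreal ((norm (g x - gradient \<phi> x))\<^sup>2 + (u x - \<phi> x)\<^sup>2) \<partial>lebesgue)
      < ennreal ((1 / Suc n)\<^sup>2)" for n
    using u unfolding H1_0_def g_def by (auto simp del: of_nat_Suc)
  then have "\<forall>n. \<exists>\<phi>. \<phi> \<in> test_functions \<Omega> \<and>
      (\<integral>\<^sup>+x\<in>\<Omega>. ennreal ((norm (g x - gradient \<phi> x))\<^sup>2 + (u x - \<phi> x)\<^sup>2) \<partial>lebesgue)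
      < ennreal ((1 / Suc n)\<^sup>2)" by blast
  from choice[OF this] obtain \<phi> where
    *: "\<forall>n. \<phi> n \<in> test_functions \<Omega> \<and>
      (\<integral>\<^sup>+x\<in>\<Omega>. ennreal ((norm (g x - gradient (\<phi> n) x))\<^sup>2 + (u x - \<phi> n x)\<^sup>2) \<partial>lebesgue)
      < ennreal ((1 / Suc n)\<^sup>2)" by (elim exE)
  have \<phi>: "\<phi> n \<in> test_functions \<Omega>" for n using * by simp
  have close: "(\<integral>\<^sup>+x\<in>\<Omega>. ennreal ((norm (g x - gradient (\<phi> n) x))\<^sup>2 + (u x - \<phi> n x)\<^sup>2) \<partial>lebesgue)
      < ennreal ((1 / Suc n)\<^sup>2)" for n using * by simp
  have der: "(\<phi> n has_derivative (\<lambda>v. gradient (\<phi> n) z \<bullet> v)) (at z)" for n z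
    using \<phi> by (rule test_function_has_derivative)
  have cont: "continuous_on UNIV (gradient (\<phi> n))" for n
    using \<phi> by (rule continuous_on_gradient_test_function)
  have b\<phi>: "\<phi> n \<in> borel_measurable borel" for n
    using der by (intro borel_measurable_continuous_onI continuous_at_imp_continuous_on ballI has_derivative_continuous) auto
  have bG: "gradient (\<phi> n) \<in> borel_measurable borel" for n
    using cont by (rule borel_measurable_continuous_onI)
  note [measurable] = lborelD[OF b\<phi>] lborelD[OF bG] lborelD[OF \<open>\<delta> \<in> borel_measurable borel\<close>]
  have [measurable]: "\<Omega> \<in> sets lebesgue" "S \<in> sets lebesgue" "T \<in> sets lebesgue"
    using ST_borel \<open>\<Omega> \<in> sets borel\<close> by auto
  note [measurable del] = \<open>\<delta> \<in> borel_measurable borel\<close> \<open>\<Omega> \<in> sets borel\<close> ST_borel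
  let ?e = "\<lambda>n x. indicat_real \<Omega> x * (norm (g x - gradient (\<phi> n) x))\<^sup>2"
  let ?w = "\<lambda>n x. indicat_real \<Omega> x * (u x - \<phi> n x)\<^sup>2"
  have me[measurable]: "?e n \<in> borel_measurable lebesgue" for n
  proof -
    have "?e n = (\<lambda>x. indicat_real \<Omega> x * (norm (indicat_real \<Omega> x *\<^sub>R g x - gradient (\<phi> n) x))\<^sup>2)"
      by (auto simp: indicator_def)
    then show ?thesis by simp
  qed
  have mw[measurable]: "?w n \<in> borel_measurable lebesgue" for n
  proof -
    have "?w n = (\<lambda>x. indicat_real \<Omega> x * (indicat_real \<Omega> x * u x - \<phi> n x)\<^sup>2)"
      by (auto simp: indicator_def)
    then show ?thesis by simp
  qed
  have close': "(\<integral>\<^sup>+x. ennreal (?e n x + ?w n x) \<partial>lebesgue) \<le> ennreal ((1 / Suc n)\<^sup>2)" for n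
  proof -
    have "(\<integral>\<^sup>+x. ennreal (?e n x + ?w n x) \<partial>lebesgue)
      = (\<integral>\<^sup>+x\<in>\<Omega>. ennreal ((norm (g x - gradient (\<phi> n) x))\<^sup>2 + (u x - \<phi> n x)\<^sup>2) \<partial>lebesgue)"
      by (intro nn_integral_cong) (auto simp: indicator_def)
    with close[of n] show ?thesis by simp
  qed
  have wle: "(\<integral>\<^sup>+x. ennreal (?w n x) \<partial>lebesgue) \<le> ennreal ((1 / Suc n)\<^sup>2)" for n
    by (rule order_trans[OF nn_integral_mono close']) (auto intro!: ennreal_leI)
  have lim0: "(\<lambda>n. (1 / real (Suc n))\<^sup>2) \<longlonglongrightarrow> 0"
  proof -
    have "(\<lambda>n. (1 / real (Suc n))\<^sup>2) \<longlonglongrightarrow> 0\<^sup>2"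
      by (intro tendsto_power LIMSEQ_Suc[OF lim_1_over_n])
    then show ?thesis by (simp only: power_zero_numeral)
  qed
  have "\<exists>r::nat \<Rightarrow> nat. strict_mono r \<and> (AE x in lebesgue. (\<lambda>n. ?w (r n) x) \<longlonglongrightarrow> 0)"
  proof (rule tendsto_L1_AE_subseq[of lebesgue ?w])
    show int: "integrable lebesgue (?w n)" for n
      using le_less_trans[OF wle ennreal_less_top] by (intro integrableI_nonneg) auto
    have "(LINT x|lebesgue. norm (?w n x)) \<le> (1 / real (Suc n))\<^sup>2" for n
    proof -
      have "ennreal (LINT x|lebesgue. ?w n x) = (\<integral>\<^sup>+x. ennreal (?w n x) \<partial>lebesgue)"
        by (rule nn_integral_eq_integral[symmetric, OF int]) auto
      then have "ennreal (LINT x|lebesgue. ?w n x) \<le> ennreal ((1 / Suc n)\<^sup>2)" using wle by simp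
      then show ?thesis by (simp add: ennreal_le_iff2)
    qed
    then show "(\<lambda>n. LINT x|lebesgue. norm (?w n x)) \<longlonglongrightarrow> 0"
      by (intro tendsto_sandwich[OF _ _ tendsto_const lim0]) auto
  qed
  then obtain r :: "nat \<Rightarrow> nat" where
    r: "strict_mono r" "AE x in lebesgue. (\<lambda>n. ?w (r n) x) \<longlonglongrightarrow> 0"
    by blast
  have conv: "AE x in lebesgue. x \<in> \<Omega> \<longrightarrow> (\<lambda>n. \<phi> (r n) x) \<longlonglongrightarrow> u x"
    using r(2)
  proof eventually_elim
    case (elim x)
    show ?case
    proof
      assume "x \<in> \<Omega>"
      then have "(\<lambda>n. (u x - \<phi> (r n) x)\<^sup>2) \<longlonglongrightarrow> 0" using elim by simp
      then have "(\<lambda>n. u x - \<phi> (r n) x) \<longlonglongrightarrow> 0"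
        using tendsto_real_sqrt[of "\<lambda>n. (u x - \<phi> (r n) x)\<^sup>2" 0 sequentially]
        by (simp add: tendsto_rabs_zero_iff)
      from tendsto_diff[OF tendsto_const[of "u x"] this] show "(\<lambda>n. \<phi> (r n) x) \<longlonglongrightarrow> u x" by simp
    qed
  qed
  let ?D = "\<lambda>x. ennreal ((norm (g x))\<^sup>2 + (u x)\<^sup>2 / (\<delta> x)\<^sup>2) * indicator \<Omega> x"
  have mD[measurable]: "?D \<in> borel_measurable lebesgue"
  proof -
    have *: "?D = (\<lambda>x. ennreal ((norm (indicat_real \<Omega> x *\<^sub>R g x))\<^sup>2 + (indicat_real \<Omega> x * u x)\<^sup>2 / (\<delta> x)\<^sup>2) * indicator \<Omega> x)"
      by (auto simp: indicator_def)
    show ?thesis by (subst *) measurable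
  qed
  obtain E0 where E0: "0 \<le> E0" "(\<integral>\<^sup>+x. ?D x \<partial>lebesgue) = ennreal E0" "E0 < E"
    using E unfolding g_def[symmetric] \<delta>_def[symmetric]
    by (cases "\<integral>\<^sup>+x. ?D x \<partial>lebesgue") (auto simp: ennreal_less_iff)
  \<comment> \<open>\<open>\<eta>\<close> is so small that enlarging \<open>E0\<close> by the factor \<open>1 + \<eta>\<close> uses up at most half of the gap
      \<open>E - E0\<close>; the other half is left for the approximation error, whose factor is \<open>C\<close>.\<close>
  define \<eta> where "\<eta> = (E - E0) / (2 * (E0 + 1))"
  define C where "C = (1 + 1 / \<eta>) * max 1 (4 / \<epsilon>\<^sup>2)"
  have \<eta>: "0 < \<eta>" "(1 + \<eta>) * E0 \<le> (E0 + E) / 2" using E0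
    by (simp_all add: \<eta>_def field_simps)
  have C: "0 < C" using \<eta> by (simp add: C_def add_pos_pos)
  have energy: "(\<integral>\<^sup>+z\<in>T. ennreal ((norm (gradient (\<phi> n) z))\<^sup>2 + (\<phi> n z)\<^sup>2 / (\<delta> z)\<^sup>2) \<partial>lborel)
      \<le> ennreal ((E0 + E) / 2 + C * (1 / Suc n)\<^sup>2)" for n
  proof -
    have pt: "ennreal ((norm (gradient (\<phi> n) z))\<^sup>2 + (\<phi> n z)\<^sup>2 / (\<delta> z)\<^sup>2) * indicator T z
        \<le> ennreal (1 + \<eta>) * ?D z + ennreal C * ennreal (?e n z + ?w n z)" for z
    proof (cases "z \<in> T")
      case True
      then have z: "z \<in> \<Omega>" "\<epsilon> / 2 \<le> \<delta> z" by (auto simp: T_def)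
      then have \<delta>z: "0 < \<delta> z" using \<open>0 < \<epsilon>\<close> by linarith
      have "(\<epsilon> / 2)\<^sup>2 \<le> (\<delta> z)\<^sup>2" using z \<open>0 < \<epsilon>\<close> by (intro power_mono) auto
      then have inv: "1 / (\<delta> z)\<^sup>2 \<le> 4 / \<epsilon>\<^sup>2"
        using \<delta>z \<open>0 < \<epsilon>\<close> by (simp add: field_simps)
      have "(\<phi> n z)\<^sup>2 \<le> (1 + \<eta>) * (u z)\<^sup>2 + (1 + 1 / \<eta>) * (u z - \<phi> n z)\<^sup>2"
        using norm_sq_le_Peter_Paul[OF \<eta>(1), of "\<phi> n z" "u z"] by simp
      then have "(\<phi> n z)\<^sup>2 * (1 / (\<delta> z)\<^sup>2) \<le> ((1 + \<eta>) * (u z)\<^sup>2 + (1 + 1 / \<eta>) * (u z - \<phi> n z)\<^sup>2) * (1 / (\<delta> z)\<^sup>2)"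
        by (rule mult_right_mono) simp
      also have "\<dots> = (1 + \<eta>) * ((u z)\<^sup>2 / (\<delta> z)\<^sup>2) + (1 + 1 / \<eta>) * (u z - \<phi> n z)\<^sup>2 * (1 / (\<delta> z)\<^sup>2)"
        by (simp only: distrib_right) simp
      also have "(1 + 1 / \<eta>) * (u z - \<phi> n z)\<^sup>2 * (1 / (\<delta> z)\<^sup>2) \<le> (1 + 1 / \<eta>) * (u z - \<phi> n z)\<^sup>2 * max 1 (4 / \<epsilon>\<^sup>2)"
        using inv \<eta> by (intro mult_left_mono) auto
      also have "\<dots> = C * (u z - \<phi> n z)\<^sup>2" by (simp add: C_def)
      finally have 1: "(\<phi> n z)\<^sup>2 / (\<delta> z)\<^sup>2 \<le> (1 + \<eta>) * ((u z)\<^sup>2 / (\<delta> z)\<^sup>2) + C * (u z - \<phi> n z)\<^sup>2" by simp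
      have "(1 + 1 / \<eta>) * 1 \<le> C" unfolding C_def using \<eta> by (intro mult_left_mono) auto
      then have "(1 + 1 / \<eta>) * (norm (g z - gradient (\<phi> n) z))\<^sup>2 \<le> C * (norm (g z - gradient (\<phi> n) z))\<^sup>2"
        by (intro mult_right_mono) auto
      with norm_sq_le_Peter_Paul[OF \<eta>(1), of "gradient (\<phi> n) z" "g z"]
      have 2: "(norm (gradient (\<phi> n) z))\<^sup>2 \<le> (1 + \<eta>) * (norm (g z))\<^sup>2 + C * (norm (g z - gradient (\<phi> n) z))\<^sup>2"
        by linarith
      have "(norm (gradient (\<phi> n) z))\<^sup>2 + (\<phi> n z)\<^sup>2 / (\<delta> z)\<^sup>2
        \<le> (1 + \<eta>) * ((norm (g z))\<^sup>2 + (u z)\<^sup>2 / (\<delta> z)\<^sup>2)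
          + C * ((norm (g z - gradient (\<phi> n) z))\<^sup>2 + (u z - \<phi> n z)\<^sup>2)"
        using 1 2 unfolding distrib_left by linarith
      then have "ennreal ((norm (gradient (\<phi> n) z))\<^sup>2 + (\<phi> n z)\<^sup>2 / (\<delta> z)\<^sup>2)
        \<le> ennreal ((1 + \<eta>) * ((norm (g z))\<^sup>2 + (u z)\<^sup>2 / (\<delta> z)\<^sup>2)
          + C * ((norm (g z - gradient (\<phi> n) z))\<^sup>2 + (u z - \<phi> n z)\<^sup>2))"
        by (rule ennreal_leI)
      also have "\<dots> = ennreal (1 + \<eta>) * ennreal ((norm (g z))\<^sup>2 + (u z)\<^sup>2 / (\<delta> z)\<^sup>2)
          + ennreal C * ennreal ((norm (g z - gradient (\<phi> n) z))\<^sup>2 + (u z - \<phi> n z)\<^sup>2)"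
        using \<eta> C by (subst ennreal_plus) (auto simp: ennreal_mult' simp del: ennreal_plus)
      finally show ?thesis using True z by (simp del: ennreal_plus)
    qed simp
    have "(\<integral>\<^sup>+z\<in>T. ennreal ((norm (gradient (\<phi> n) z))\<^sup>2 + (\<phi> n z)\<^sup>2 / (\<delta> z)\<^sup>2) \<partial>lborel)
        = (\<integral>\<^sup>+z\<in>T. ennreal ((norm (gradient (\<phi> n) z))\<^sup>2 + (\<phi> n z)\<^sup>2 / (\<delta> z)\<^sup>2) \<partial>lebesgue)"
      by (rule nn_integral_completion[symmetric])
    also have "\<dots> \<le> (\<integral>\<^sup>+z. ennreal (1 + \<eta>) * ?D z + ennreal C * ennreal (?e n z + ?w n z) \<partial>lebesgue)"
      by (intro nn_integral_mono pt)
    also have "\<dots> = ennreal (1 + \<eta>) * (\<integral>\<^sup>+z. ?D z \<partial>lebesgue) + ennreal C * (\<integral>\<^sup>+z. ennreal (?e n z + ?w n z) \<partial>lebesgue)"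
      by (subst nn_integral_add, measurable) (subst nn_integral_cmult, measurable)+
    also have "\<dots> \<le> ennreal (1 + \<eta>) * ennreal E0 + ennreal C * ennreal ((1 / Suc n)\<^sup>2)"
      unfolding E0(2) by (intro add_left_mono mult_left_mono close') simp
    also have "\<dots> = ennreal ((1 + \<eta>) * E0 + C * (1 / Suc n)\<^sup>2)"
      using \<eta> C E0 by (subst ennreal_plus) (auto simp: ennreal_mult simp del: ennreal_plus)
    also have "\<dots> \<le> ennreal ((E0 + E) / 2 + C * (1 / Suc n)\<^sup>2)"
      using \<eta> by (intro ennreal_leI) simp
    finally show ?thesis .
  qed
  let ?B = "ennreal (3 * pi * (2 * pi * q * E) powr (q / 2))"
  let ?F = "\<lambda>n x. ennreal (\<bar>\<phi> n x\<bar> powr q / (\<delta> x)\<^sup>2) * indicator S x"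
  have "(\<lambda>n. (E0 + E) / 2 + C * (1 / real (Suc n))\<^sup>2) \<longlonglongrightarrow> (E0 + E) / 2 + C * 0"
    by (intro tendsto_intros lim0)
  then have "\<forall>\<^sub>F n in sequentially. (E0 + E) / 2 + C * (1 / real (Suc n))\<^sup>2 < E"
    by (rule order_tendstoD(2)) (use E0 in auto)
  then have "\<forall>\<^sub>F n in sequentially. (\<integral>\<^sup>+x. ?F n x \<partial>lborel) \<le> ?B"
  proof eventually_elim
    case (elim n)
    show ?case
    proof (rule weighted_Lq_estimate[OF der cont lip \<delta>0 ST_borel ST \<open>2 < q\<close>])
      show "0 < E" using E0 by simp
      show "(\<integral>\<^sup>+z\<in>T. ennreal ((norm (gradient (\<phi> n) z))\<^sup>2 + (\<phi> n z)\<^sup>2 / (\<delta> z)\<^sup>2) \<partial>lborel) \<le> ennreal E"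
        using elim by (intro order_trans[OF energy ennreal_leI]) simp
    qed
  qed
  then have ev: "\<forall>\<^sub>F n in sequentially. (\<integral>\<^sup>+x. ?F (r n) x \<partial>lebesgue) \<le> ?B"
    unfolding nn_integral_completion by (rule eventually_subseq[OF r(1)])
  have "(\<integral>\<^sup>+x\<in>S. ennreal (\<bar>u x\<bar> powr q / (\<delta> x)\<^sup>2) \<partial>lebesgue)
      = (\<integral>\<^sup>+x. liminf (\<lambda>n. ?F (r n) x) \<partial>lebesgue)"
  proof (rule nn_integral_cong_AE, use conv in eventually_elim)
    case (elim x)
    have "(\<lambda>n. ?F (r n) x) \<longlonglongrightarrow> ennreal (\<bar>u x\<bar> powr q / (\<delta> x)\<^sup>2) * indicator S x"
    proof (cases "x \<in> S")
      case True
      then have "(\<lambda>n. \<phi> (r n) x) \<longlonglongrightarrow> u x" "\<delta> x \<noteq> 0" using elim ST[of x] by (auto simp: S_def)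
      then have "(\<lambda>n. \<bar>\<phi> (r n) x\<bar> powr q / (\<delta> x)\<^sup>2) \<longlonglongrightarrow> \<bar>u x\<bar> powr q / (\<delta> x)\<^sup>2"
        using \<open>2 < q\<close> by (intro tendsto_divide tendsto_powr' tendsto_rabs tendsto_const) auto
      then show ?thesis using True by (simp add: tendsto_ennrealI)
    qed simp
    then show ?case by (simp add: lim_imp_Liminf)
  qed
  also have "\<dots> \<le> liminf (\<lambda>n. \<integral>\<^sup>+x. ?F (r n) x \<partial>lebesgue)"
    by (rule nn_integral_liminf) measurable
  also have "\<dots> \<le> limsup (\<lambda>n. \<integral>\<^sup>+x. ?F (r n) x \<partial>lebesgue)"
    by (rule Liminf_le_Limsup) simp
  also have "\<dots> \<le> ?B" by (rule Limsup_bounded[OF ev])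
  finally show ?thesis unfolding S_def \<delta>_def .
qed

text \<open>The bound on \<open>{\<delta> \<ge> \<epsilon>}\<close> does not depend on \<open>\<epsilon>\<close>, and these sets increase to \<open>\<Omega>\<close>.\<close>

lemma nn_integral_le_of_H1_0:
  fixes \<Omega> :: "(real^2) set"
  assumes \<Omega>: "open \<Omega>" "frontier \<Omega> \<noteq> {}" and u: "u \<in> H1_0 \<Omega>" and "2 < q"
    and E: "(\<integral>\<^sup>+x\<in>\<Omega>. ennreal ((norm (weak_gradient \<Omega> u x))\<^sup>2 + (u x)\<^sup>2 / (bdist \<Omega> x)\<^sup>2) \<partial>lebesgue) < ennreal E"
  shows "(\<integral>\<^sup>+x\<in>\<Omega>. ennreal (\<bar>u x\<bar> powr q / (bdist \<Omega> x)\<^sup>2) \<partial>lebesgue)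
    \<le> ennreal (3 * pi * (2 * pi * q * E) powr (q / 2))"
proof -
  define S where "S = (\<lambda>n::nat. {x \<in> \<Omega>. 1 / Suc n \<le> bdist \<Omega> x})"
  let ?f = "\<lambda>x. ennreal (\<bar>u x\<bar> powr q / (bdist \<Omega> x)\<^sup>2)"
  have [measurable]: "(\<lambda>x. indicat_real \<Omega> x * u x) \<in> borel_measurable lebesgue"
    using u by (simp add: H1_0_def H1_def L2_on_def set_borel_measurable_def)
  have b: "bdist \<Omega> \<in> borel_measurable borel"
    using bdist_lipschitz by (intro borel_measurable_continuous_onI lipschitz_on_continuous_on)
  then have [measurable]: "bdist \<Omega> \<in> borel_measurable lebesgue" by (simp add: measurable_completion)
  have "S n \<in> sets borel" for n unfolding S_def using \<Omega>(1) b by measurable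
  then have [measurable]: "S n \<in> sets lebesgue" for n by simp
  have meas: "(\<lambda>x. ?f x * indicator (S n) x) \<in> borel_measurable lebesgue" for n
  proof -
    have *: "(\<lambda>x. ?f x * indicator (S n) x) =
        (\<lambda>x. ennreal (\<bar>indicat_real \<Omega> x * u x\<bar> powr q / (bdist \<Omega> x)\<^sup>2) * indicator (S n) x)"
      by (auto simp: indicator_def S_def)
    show ?thesis by (subst *) measurable
  qed
  have "(\<integral>\<^sup>+x\<in>\<Omega>. ?f x \<partial>lebesgue) \<le> (\<integral>\<^sup>+x. (SUP n. ?f x * indicator (S n) x) \<partial>lebesgue)"
  proof (rule nn_integral_mono)
    fix x
    show "?f x * indicator \<Omega> x \<le> (SUP n. ?f x * indicator (S n) x)"
    proof (cases "x \<in> \<Omega>")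
      case True
      then obtain n where "inverse (real (Suc n)) < bdist \<Omega> x"
        using reals_Archimedean[OF bdist_pos[OF \<Omega>]] by blast
      then have "x \<in> S n" using True by (simp add: S_def inverse_eq_divide)
      then have "?f x * indicator \<Omega> x = ?f x * indicator (S n) x" using True by simp
      also have "\<dots> \<le> (SUP n. ?f x * indicator (S n) x)" by (rule SUP_upper) simp
      finally show ?thesis .
    qed simp
  qed
  also have "\<dots> = (SUP n. \<integral>\<^sup>+x. ?f x * indicator (S n) x \<partial>lebesgue)"
  proof (rule nn_integral_monotone_convergence_SUP[OF _ meas])
    have "S m \<subseteq> S n" if "m \<le> n" for m n
    proof -
      have "1 / real (Suc n) \<le> 1 / real (Suc m)" using that by (simp add: field_simps)
      then show ?thesis by (auto simp: S_def simp del: of_nat_Suc)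
    qed
    then show "incseq (\<lambda>n x. ?f x * indicator (S n) x)"
      by (auto simp: incseq_def le_fun_def intro!: mult_left_mono) (auto simp: indicator_def)
  qed
  also have "\<dots> \<le> ennreal (3 * pi * (2 * pi * q * E) powr (q / 2))"
    unfolding S_def using assms by (intro SUP_least nn_integral_truncated_le_of_H1_0) auto
  finally show ?thesis .
qed

text \<open>Taking \<open>q\<close>-th roots turns \<open>3 \<pi> * (2 \<pi> q E) powr (q/2)\<close> into
  \<open>(3 \<pi>) powr (1/q) * sqrt (2 \<pi> q E)\<close>, and for \<open>q > 2\<close> this is at most \<open>3 \<pi> * sqrt (q E)\<close>. It remains
  to let \<open>E\<close> decrease to the energy of \<open>u\<close>. The constant \<open>3 \<pi> * sqrt q\<close> is of order \<open>q powr (1/2)\<close>,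
  which is at most \<open>q powr (1/2 + 1/q)\<close> for \<open>q \<ge> 1\<close>.\<close>

theorem theorem2:
  shows "\<exists>\<Sigma> :: real \<Rightarrow> real.
    (\<forall>q>2. 0 < \<Sigma> q) \<and>
    \<Sigma> \<in> O[at_top](\<lambda>q. q powr (1/2 + 1/q)) \<and>
    (\<forall>\<Omega> :: (real^2) set. open \<Omega> \<and> connected \<Omega> \<and> frontier \<Omega> \<noteq> {} \<longrightarrow>
      (\<forall>u\<in>H1_0 \<Omega>. \<forall>q>2.
        ennpowr (\<integral>\<^sup>+ x\<in>\<Omega>. ennreal (\<bar>u x\<bar> powr q / (bdist \<Omega> x)\<^sup>2) \<partial>lebesgue) (1/q)
        \<le> ennreal (\<Sigma> q) *
          ennpowr (\<integral>\<^sup>+ x\<in>\<Omega>. ennreal ((norm (weak_gradient \<Omega> u x))\<^sup>2 + (u x)\<^sup>2 / (bdist \<Omega> x)\<^sup>2)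
            \<partial>lebesgue) (1/2)))"
proof (intro exI[of _ "\<lambda>q. 3 * pi * q powr (1 / 2)"] conjI allI ballI impI)
  show "0 < 3 * pi * q powr (1 / 2)" if "2 < q" for q :: real
    using that by simp
  show "(\<lambda>q. 3 * pi * q powr (1 / 2)) \<in> O[at_top](\<lambda>q. q powr (1 / 2 + 1 / q))"
  proof (rule bigoI[of _ "3 * pi"])
    show "\<forall>\<^sub>F q in at_top. norm (3 * pi * q powr (1 / 2)) \<le> 3 * pi * norm (q powr (1 / 2 + 1 / q))"
      using eventually_ge_at_top[of "1::real"]
      by eventually_elim (auto intro!: powr_mono)
  qed
next
  fix \<Omega> :: "(real^2) set" and u and q :: real
  assume "open \<Omega> \<and> connected \<Omega> \<and> frontier \<Omega> \<noteq> {}" and u: "u \<in> H1_0 \<Omega>" and q: "2 < q"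
  then have \<Omega>: "open \<Omega>" "frontier \<Omega> \<noteq> {}" by auto
  define I where "I = (\<integral>\<^sup>+ x\<in>\<Omega>. ennreal (\<bar>u x\<bar> powr q / (bdist \<Omega> x)\<^sup>2) \<partial>lebesgue)"
  define D where "D = (\<integral>\<^sup>+ x\<in>\<Omega>. ennreal ((norm (weak_gradient \<Omega> u x))\<^sup>2 + (u x)\<^sup>2 / (bdist \<Omega> x)\<^sup>2) \<partial>lebesgue)"
  show "ennpowr I (1 / q) \<le> ennreal (3 * pi * q powr (1 / 2)) * ennpowr D (1 / 2)"
  proof (cases D)
    case top
    then show ?thesis using q by (simp add: ennpowr_def ennreal_mult_top)
  next
    case (real d)
    have bound: "I \<le> ennreal (3 * pi * (2 * pi * q * E) powr (q / 2))" if "d < E" for E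
      unfolding I_def
      by (rule nn_integral_le_of_H1_0[OF \<Omega> u q, folded D_def]) (use that real in \<open>simp add: ennreal_less_iff\<close>)
    have "I \<noteq> top" using bound[of "d + 1"] by (auto simp: top_unique)
    then obtain i where i: "0 \<le> i" "I = ennreal i" by (cases I) auto
    have "i powr (2 / q) / (9 * pi\<^sup>2 * q) \<le> E" if "d < E" for E
    proof -
      have E: "0 < E" using that real by simp
      have "i \<le> 3 * pi * (2 * pi * q * E) powr (q / 2)"
        using bound[OF that] i by simp
      then have "i powr (2 / q) \<le> (3 * pi * (2 * pi * q * E) powr (q / 2)) powr (2 / q)"
        using i q by (intro powr_mono2) auto
      also have "\<dots> = (3 * pi) powr (2 / q) * (2 * pi * q * E)"
        using q E by (simp add: powr_mult powr_powr)
      also have "\<dots> \<le> (3 * pi) powr 1 * (3 * pi * q * E)"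
        using q E pi_gt3 by (intro mult_mono powr_mono) auto
      also have "\<dots> = (9 * pi\<^sup>2 * q) * E" by (simp add: power2_eq_square)
      finally show ?thesis using q by (simp add: field_simps)
    qed
    then have "i powr (2 / q) / (9 * pi\<^sup>2 * q) \<le> d" by (rule dense_ge)
    then have "i powr (2 / q) \<le> (3 * pi)\<^sup>2 * q * d" using q by (simp add: field_simps)
    then have "(i powr (2 / q)) powr (1 / 2) \<le> ((3 * pi)\<^sup>2 * q * d) powr (1 / 2)"
      by (intro powr_mono2) auto
    then have "i powr (1 / q) \<le> 3 * pi * q powr (1 / 2) * d powr (1 / 2)"
      using q real by (simp add: powr_powr powr_mult powr_half_sqrt)
    then show ?thesis
      using real i by (simp add: ennpowr_def ennreal_mult'[symmetric] ennreal_leI)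
  qed
qed

end
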